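(* Let $G=(V,E,r,s)$ be a directed graph. Then the mapping $T$ from the set of all congruences on $\mathrm{Inv}(G)$ to the set of all congruence triples of $G$, and the mapping $\wp$ from the set of all congruence triples of $G$ to the set of all congruences on $\mathrm{Inv}(G)$, are inverse to each other. In particular, there exists a one-to-one correspondence between congruences on $\mathrm{Inv}(G)$ and congruence triples of $G$.
   Context: A directed graph $G=(V,E,r,s)$ consists of sets $V$ (vertices), $E$ (edges) and functions $r,s:E\to V$ (range and source). The index of a vertex $v$ is $|s^{-1}(v)|$. The graph inverse semigroup $\mathrm{Inv}(G)$ is the semigroup with zero generated by $V$, $E$ and $E^*=\{e^*: e\in E\}$ subject to, for all $u,v\in V$, $e,f\in E$: $uv=\delta_{u,v}u$; $s(e)e=er(e)=e$; $r(e)e^*=e^*s(e)=e^*$; $f^*e=\delta_{f,e}r(e)$. A path is a sequence $\alpha=e_1\cdots e_n$ ($n\ge1$) of edges with $r(e_i)=s(e_{i+1})$; $s(\alpha)=s(e_1)$, $r(\alpha)=r(e_n)$, $\alpha^*=e_n^*\cdots e_1^*$. A vertex $v$ is a path of length $0$ with $s(v)=r(v)=v$, $v^*=v$. Every nonzero element of $\mathrm{Inv}(G)$ is uniquely $\alpha\beta^*$ with $\alpha,\beta$ paths, $r(\alpha)=r(\beta)$. A path $e_1\cdots e_n$ ($n\ge 1$) is a cycle if $s(e_1)=r(e_n)$ and $s(e_i)\ne s(e_j)$ for $i\ne j$; its vertices are $s(e_1),\dots,s(e_n)$. A subset $H\subseteq V$ is hereditary if $s(e)\in H$ implies $r(e)\in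 H$ for all $e\in E$ ($\emptyset$ and $V$ are hereditary). For $H$ hereditary, $G\setminus H$ is the graph with vertex set $V\setminus H$, edge set $E_1=\{e\in E: r(e)\notin H\}$, and source and range maps $s_{G\setminus H}=s|_{E_1}$, $r_{G\setminus H}=r|_{E_1}$. For any graph $G'$, a congruence pair $(W,f)$ of $G'$ consists of a set $W$ of vertices of index one in $G'$ and a function $f:\mathrm{C}(W)\to\mathbb{Z}^+\cup\{\infty\}$ invariant under cyclic permutations of cycles, where $\mathrm{C}(W)$ is the set of all cycles of $G'$ whose vertices all lie in $W$ and $\mathbb Z^+$ is the set of positive integers. A congruence triple of $G$ is $(H,W,f)$ where $H\subseteq V$ is hereditary and $(W,f)$ is a congruence pair of $G\setminus H$ (so $\mathrm{C}(W)$ consists of cycles in $G\setminus H$). Mapping $T$: for a congruence $\rho$ on $\mathrm{Inv}(G)$, $T(\rho)=(H,W,f)$ where $H=\{v\in V: v\,\rho\,0\}$ (a hereditary set), $W=\{v\in V\setminus H: ee^*\,\rho\, v\text{ for some } e\in s_{G\setminus H}^{-1}(v)\}$ (all such vertices have index one in $G\setminus H$), and for $c\in\mathrm{C}(W)$, $f(c)$ is the smallest positive integer $m$ with $c^m\,\rho\, s(c)$, or $f(c)=\infty$ if no such $m$ exists. Mapping $\wp$: for a congruence triple $(H,W,f)$, $\wp(H,W,f)$ is the congruence on $\mathrm{Inv}(G)$ generated by all pairs $(v,0)$ for $v\in H$, $(ee^*,w)$ for $w\in W$ and $e\in E_1$ with $s_{G\setminus H}(e)=w$, and $(c^{f(c)},s(c))$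 for $c\in\mathrm{C}(W)$ with $f(c)\in\mathbb{Z}^+$. *)

theory Defs
  imports "Graph_Theory.Graph_Theory" "HOL-Library.Extended_Nat" "HOL-Library.FuncSet"
begin

text \<open>
  Directed graphs are the (possibly infinite) multigraphs \<^typ>\<open>('v, 'e) pre_digraph\<close>
  satisfying \<^const>\<open>wf_digraph\<close>.  The source map is \<^const>\<open>tail\<close>, the range map is \<^const>\<open>head\<close>,
  and the index of a vertex is \<^const>\<open>out_degree\<close>; the latter is 0 for vertices
  of infinite index, which is harmless because only index one matters.
\<close>

section \<open>Semigroup congruences\<close>

text \<open>A semigroup is given by its carrier \<open>S\<close> and its multiplication \<open>mul\<close>.\<close>

definition congruence_on :: "'s set \<Rightarrow> ('s \<Rightarrow> 's \<Rightarrow> 's) \<Rightarrow> ('s \<times> 's) set \<Rightarrow> bool" where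
  "congruence_on S mul \<rho> \<longleftrightarrow> equiv S \<rho> \<and>
     (\<forall>(a, b) \<in> \<rho>. \<forall>c \<in> S. (mul c a, mul c b) \<in> \<rho> \<and> (mul a c, mul b c) \<in> \<rho>)"

definition generated_congruence :: "'s set \<Rightarrow> ('s \<Rightarrow> 's \<Rightarrow> 's) \<Rightarrow> ('s \<times> 's) set \<Rightarrow> ('s \<times> 's) set" where
  "generated_congruence S mul R = \<Inter>{\<rho>. congruence_on S mul \<rho> \<and> R \<subseteq> \<rho>}"

definition quotient_mult ::
  "('s \<Rightarrow> 's \<Rightarrow> 's) \<Rightarrow> ('s \<times> 's) set \<Rightarrow> 's set \<Rightarrow> 's set \<Rightarrow> 's set" where
  "quotient_mult mul \<rho> A B = (\<Union>a\<in>A. \<Union>b\<in>B. \<rho> `` {mul a b})"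

lemma quotient_mult_class:
  assumes \<rho>: "congruence_on S mul \<rho>" and a: "a \<in> S" and b: "b \<in> S"
  shows "quotient_mult mul \<rho> (\<rho> `` {a}) (\<rho> `` {b}) = \<rho> `` {mul a b}"
proof -
  have eq: "equiv S \<rho>" using \<rho> by (simp add: congruence_on_def)
  have "\<rho> `` {mul a' b'} = \<rho> `` {mul a b}" if "(a, a') \<in> \<rho>" "(b, b') \<in> \<rho>" for a' b'
  proof -
    have "a' \<in> S" using eq that(1) by (auto simp: equiv_def)
    then have "(mul a b, mul a' b) \<in> \<rho>" "(mul a' b, mul a' b') \<in> \<rho>"
      using \<rho> that b unfolding congruence_on_def by blast+
    then have "(mul a b, mul a' b') \<in> \<rho>"
      using eq by (meson equiv_def transD)
    then show ?thesis using equiv_class_eq[OF eq] by blast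
  qed
  moreover have "(a, a) \<in> \<rho>" "(b, b) \<in> \<rho>"
    using eq a b by (auto simp: equiv_def refl_on_def)
  ultimately show ?thesis unfolding quotient_mult_def by blast
qed

text \<open>The power \<open>x^m\<close> for \<open>m \<ge> 1\<close>; the value at \<open>m = 0\<close> is irrelevant.\<close>

definition semigroup_power :: "('s \<Rightarrow> 's \<Rightarrow> 's) \<Rightarrow> 's \<Rightarrow> nat \<Rightarrow> 's" where
  "semigroup_power mul x m = ((\<lambda>y. mul y x) ^^ (m - 1)) x"


section \<open>The graph inverse semigroup\<close>

datatype ('v, 'e) generator = Vertex 'v | Edge 'e | Ghost 'e

text \<open>
  \<open>Ghost e\<close> is the generator \<open>e\<^sup>*\<close>.  The free semigroup with zero consists of the nonempty
  words \<open>Some w\<close> over the generators together with the zero \<open>None\<close>.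
\<close>

type_synonym ('v, 'e) word0 = "('v, 'e) generator list option"

definition generators :: "('v, 'e) pre_digraph \<Rightarrow> ('v, 'e) generator set" where
  "generators G = Vertex ` verts G \<union> Edge ` arcs G \<union> Ghost ` arcs G"

definition free0 :: "('v, 'e) pre_digraph \<Rightarrow> ('v, 'e) word0 set" where
  "free0 G = insert None (Some ` {w. w \<noteq> [] \<and> set w \<subseteq> generators G})"

fun free0_mult :: "('v, 'e) word0 \<Rightarrow> ('v, 'e) word0 \<Rightarrow> ('v, 'e) word0" where
  "free0_mult (Some u) (Some w) = Some (u @ w)"
| "free0_mult _ _ = None"

inductive_set inv_relations :: "('v, 'e) pre_digraph \<Rightarrow> (('v, 'e) word0 \<times> ('v, 'e) word0) set"
  for G :: "('v, 'e) pre_digraph" where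
  vertices: "\<lbrakk>u \<in> verts G; v \<in> verts G\<rbrakk> \<Longrightarrow>
    (Some [Vertex u, Vertex v], if u = v then Some [Vertex u] else None) \<in> inv_relations G"
| source_edge: "e \<in> arcs G \<Longrightarrow> (Some [Vertex (tail G e), Edge e], Some [Edge e]) \<in> inv_relations G"
| edge_range: "e \<in> arcs G \<Longrightarrow> (Some [Edge e, Vertex (head G e)], Some [Edge e]) \<in> inv_relations G"
| range_ghost: "e \<in> arcs G \<Longrightarrow> (Some [Vertex (head G e), Ghost e], Some [Ghost e]) \<in> inv_relations G"
| ghost_source: "e \<in> arcs G \<Longrightarrow> (Some [Ghost e, Vertex (tail G e)], Some [Ghost e]) \<in> inv_relations G"
| ghost_edge: "\<lbrakk>e \<in> arcs G; f \<in> arcs G\<rbrakk> \<Longrightarrow>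
    (Some [Ghost f, Edge e], if f = e then Some [Vertex (head G e)] else None) \<in> inv_relations G"

definition inv_cong :: "('v, 'e) pre_digraph \<Rightarrow> (('v, 'e) word0 \<times> ('v, 'e) word0) set" where
  "inv_cong G = generated_congruence (free0 G) free0_mult (inv_relations G)"

type_synonym ('v, 'e) inv_elem = "('v, 'e) word0 set"

definition Inv :: "('v, 'e) pre_digraph \<Rightarrow> ('v, 'e) inv_elem set" where
  "Inv G = free0 G // inv_cong G"

definition inv_mult ::
  "('v, 'e) pre_digraph \<Rightarrow> ('v, 'e) inv_elem \<Rightarrow> ('v, 'e) inv_elem \<Rightarrow> ('v, 'e) inv_elem" where
  "inv_mult G = quotient_mult free0_mult (inv_cong G)"

definition inv_zero :: "('v, 'e) pre_digraph \<Rightarrow> ('v, 'e) inv_elem" where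
  "inv_zero G = inv_cong G `` {None}"

definition inv_word :: "('v, 'e) pre_digraph \<Rightarrow> ('v, 'e) generator list \<Rightarrow> ('v, 'e) inv_elem" where
  "inv_word G w = inv_cong G `` {Some w}"

definition inv_vertex :: "('v, 'e) pre_digraph \<Rightarrow> 'v \<Rightarrow> ('v, 'e) inv_elem" where
  "inv_vertex G v = inv_word G [Vertex v]"

definition inv_edge :: "('v, 'e) pre_digraph \<Rightarrow> 'e \<Rightarrow> ('v, 'e) inv_elem" where
  "inv_edge G e = inv_word G [Edge e]"

definition inv_ghost :: "('v, 'e) pre_digraph \<Rightarrow> 'e \<Rightarrow> ('v, 'e) inv_elem" where
  "inv_ghost G e = inv_word G [Ghost e]"

text \<open>The element \<open>e\<^sub>1 \<dots> e\<^sub>n\<close> of a path of length \<open>n \<ge> 1\<close>.\<close>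

definition inv_path :: "('v, 'e) pre_digraph \<Rightarrow> 'e list \<Rightarrow> ('v, 'e) inv_elem" where
  "inv_path G \<alpha> = inv_word G (map Edge \<alpha>)"

definition inv_congruences ::
  "('v, 'e) pre_digraph \<Rightarrow> (('v, 'e) inv_elem \<times> ('v, 'e) inv_elem) set set" where
  "inv_congruences G = {\<rho>. congruence_on (Inv G) (inv_mult G) \<rho>}"


section \<open>Congruence triples\<close>

definition hereditary :: "('v, 'e) pre_digraph \<Rightarrow> 'v set \<Rightarrow> bool" where
  "hereditary G H \<longleftrightarrow> H \<subseteq> verts G \<and> (\<forall>e \<in> arcs G. tail G e \<in> H \<longrightarrow> head G e \<in> H)"

definition remove_hereditary :: "('v, 'e) pre_digraph \<Rightarrow> 'v set \<Rightarrow> ('v, 'e) pre_digraph" where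
  "remove_hereditary G H =
     \<lparr>verts = verts G - H, arcs = {e \<in> arcs G. head G e \<notin> H}, tail = tail G, head = head G\<rparr>"

text \<open>
  \<^const>\<open>pre_digraph.cycle\<close> requires the ranges of the edges of a closed path to be pairwise
  distinct; along a closed path these are the sources up to a cyclic shift.
\<close>

lemma cycle_iff_distinct_sources:
  "pre_digraph.cycle G c \<longleftrightarrow>
     c \<noteq> [] \<and> pre_digraph.awalk G (tail G (hd c)) c (tail G (hd c)) \<and> distinct (map (tail G) c)"
proof -
  have verts: "pre_digraph.awalk_verts G u c = map (tail G) c @ [v]"
    if "pre_digraph.cas G u c v" for u v
    using that
    by (induction c arbitrary: u) (auto simp: pre_digraph.cas.simps pre_digraph.awalk_verts.simps)
  have "distinct (tl (pre_digraph.awalk_verts G u c)) \<longleftrightarrow> distinct (map (tail G) c)"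
    if "c \<noteq> []" "pre_digraph.cas G u c u" for u
    using that verts[OF that(2)] by (cases c) (auto simp: pre_digraph.cas.simps)
  moreover have "u = tail G (hd c)" if "c \<noteq> []" "pre_digraph.cas G u c u" for u
    using that by (cases c) (auto simp: pre_digraph.cas.simps)
  ultimately show ?thesis
    unfolding pre_digraph.cycle_def pre_digraph.awalk_def by metis
qed

definition cycles_in :: "('v, 'e) pre_digraph \<Rightarrow> 'v set \<Rightarrow> 'e list set" where
  "cycles_in G W = {c. pre_digraph.cycle G c \<and> tail G ` set c \<subseteq> W}"

text \<open>
  \<open>\<int>\<^sup>+ \<union> {\<infinity>}\<close> is the set of nonzero elements of \<^typ>\<open>enat\<close>.  A function on \<open>C(W)\<close> is
  extensional, so that equality of congruence pairs only concerns its values on \<open>C(W)\<close>.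
\<close>

definition congruence_pair :: "('v, 'e) pre_digraph \<Rightarrow> 'v set \<Rightarrow> ('e list \<Rightarrow> enat) \<Rightarrow> bool" where
  "congruence_pair G W f \<longleftrightarrow>
     W \<subseteq> {v \<in> verts G. out_degree G v = 1} \<and>
     f \<in> cycles_in G W \<rightarrow>\<^sub>E {0<..} \<and>
     (\<forall>c \<in> cycles_in G W. \<forall>n. f (rotate n c) = f c)"

type_synonym ('v, 'e) triple = "'v set \<times> 'v set \<times> ('e list \<Rightarrow> enat)"

definition congruence_triples :: "('v, 'e) pre_digraph \<Rightarrow> ('v, 'e) triple set" where
  "congruence_triples G =
     {(H, W, f). hereditary G H \<and> congruence_pair (remove_hereditary G H) W f}"


section \<open>The two mappings\<close>

definition T_vertices ::
  "('v, 'e) pre_digraph \<Rightarrow> (('v, 'e) inv_elem \<times> ('v, 'e) inv_elem) set \<Rightarrow> 'v set" where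
  "T_vertices G \<rho> = {v \<in> verts G. (inv_vertex G v, inv_zero G) \<in> \<rho>}"

definition T_index_one ::
  "('v, 'e) pre_digraph \<Rightarrow> (('v, 'e) inv_elem \<times> ('v, 'e) inv_elem) set \<Rightarrow> 'v set" where
  "T_index_one G \<rho> = {v \<in> verts G - T_vertices G \<rho>.
     \<exists>e \<in> out_arcs (remove_hereditary G (T_vertices G \<rho>)) v.
       (inv_mult G (inv_edge G e) (inv_ghost G e), inv_vertex G v) \<in> \<rho>}"

definition T_exponent ::
  "('v, 'e) pre_digraph \<Rightarrow> (('v, 'e) inv_elem \<times> ('v, 'e) inv_elem) set \<Rightarrow> 'e list \<Rightarrow> enat" where
  "T_exponent G \<rho> =
     (\<lambda>c \<in> cycles_in (remove_hereditary G (T_vertices G \<rho>)) (T_index_one G \<rho>).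
       let P = (\<lambda>m. m \<ge> 1 \<and>
         (semigroup_power (inv_mult G) (inv_path G c) m, inv_vertex G (tail G (hd c))) \<in> \<rho>)
       in if \<exists>m. P m then enat (LEAST m. P m) else \<infinity>)"

definition T_map ::
  "('v, 'e) pre_digraph \<Rightarrow> (('v, 'e) inv_elem \<times> ('v, 'e) inv_elem) set \<Rightarrow> ('v, 'e) triple" where
  "T_map G \<rho> = (T_vertices G \<rho>, T_index_one G \<rho>, T_exponent G \<rho>)"

fun wp_pairs ::
  "('v, 'e) pre_digraph \<Rightarrow> ('v, 'e) triple \<Rightarrow> (('v, 'e) inv_elem \<times> ('v, 'e) inv_elem) set" where
  "wp_pairs G (H, W, f) =
     {(inv_vertex G v, inv_zero G) | v. v \<in> H} \<union>
     {(inv_mult G (inv_edge G e) (inv_ghost G e), inv_vertex G w) | e w.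
        w \<in> W \<and> e \<in> out_arcs (remove_hereditary G H) w} \<union>
     {(semigroup_power (inv_mult G) (inv_path G c) m, inv_vertex G (tail G (hd c))) | c m.
        c \<in> cycles_in (remove_hereditary G H) W \<and> f c = enat m}"

definition wp_map ::
  "('v, 'e) pre_digraph \<Rightarrow> ('v, 'e) triple \<Rightarrow> (('v, 'e) inv_elem \<times> ('v, 'e) inv_elem) set" where
  "wp_map G t = generated_congruence (Inv G) (inv_mult G) (wp_pairs G t)"

end

(*
  Modulo a congruence rho every element is zero or alpha beta* with r(alpha) = r(beta) outside H. An
  identity between two such elements is reduced, by cancelling common edges and by moving a leading edge
  from one side to the other as a ghost edge (its source is then in W, so this can be undone), to an
  identity p = s(p) for a closed path p. All vertices of p lie in W, hence have index one, so p is a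
  power of a cycle c, and the exponent is a multiple of f(c). Thus rho is generated by the pairs of T(rho).
  Conversely, a triple is recovered from the congruence it generates by letting Inv(G) act by partial
  injections on infinite walks, which separates the elements that have to be separated.
*)

theory Submission
  imports Defs "HOL-Library.Stream"
begin

section \<open>Normal forms in quotients of the graph inverse semigroup\<close>

text \<open>Quotients of \<open>Inv G\<close> have no canonical representatives: once ee* = s(e)
  holds, one element has many forms \<alpha>\<beta>*. Uniqueness of normal forms is therefore
  avoided altogether. To see that the generated congruence is not too small, it and \<rho> are both
  viewed as quotients of the same words, and an equation is carried from the coarser quotient to the
  finer one. To see that it is not too large, an invariant is needed. In the action, ee* is the
  identity on the walks from s(e) exactly when all of them begin with e; this dictates the extra
  loops. A walk that starts on a cycle inside W follows it forever, so the cycle fixes the walk and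
  walks alone cannot see f. The counter supplies what is missing, but a single modulus M must suit
  all cycles that the walks meet. Hence for each cycle c only the walks that end up on c are used,
  with M equal to f(c) times the length of c, and M = 0, an unreduced integer, if f(c) is
  infinite.\<close>

lemma (in wf_digraph) awalk_append_ex_iff:
  "awalk u (p @ q) v \<longleftrightarrow> (\<exists>w. awalk u p w \<and> awalk w q v)"
  by (metis awalk_append_iff awalk_appendI)

abbreviation path_word :: "'e list \<Rightarrow> ('v, 'e) generator list" where
  "path_word p \<equiv> map Edge p"

abbreviation ghost_word :: "'e list \<Rightarrow> ('v, 'e) generator list" where
  "ghost_word p \<equiv> map Ghost (rev p)"

text \<open>
  \<open>q\<close> is the quotient map of a semigroup congruence on the free semigroup with zero, with words over
  foreign generators sent to the zero \<open>z\<close> and the empty word kept apart, so that it is total on lists.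
\<close>

locale inverse_quotient = wf_digraph G
  for G :: "('v, 'e) pre_digraph" and q :: "('v, 'e) generator list \<Rightarrow> 'a" and z :: 'a +
  assumes context_cong: "q s = q t \<Longrightarrow> q (x @ s @ y) = q (x @ t @ y)"
    and context_zero: "q s = z \<Longrightarrow> q (x @ s @ y) = z"
    and foreign: "g \<notin> generators G \<Longrightarrow> q [g] = z"
    and vertex_idem: "q [Vertex v, Vertex v] = q [Vertex v]"
    and vertex_orth: "u \<noteq> v \<Longrightarrow> q [Vertex u, Vertex v] = z"
    and source_edge: "e \<in> arcs G \<Longrightarrow> q [Vertex (tail G e), Edge e] = q [Edge e]"
    and edge_range: "e \<in> arcs G \<Longrightarrow> q [Edge e, Vertex (head G e)] = q [Edge e]"
    and range_ghost: "e \<in> arcs G \<Longrightarrow> q [Vertex (head G e), Ghost e] = q [Ghost e]"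
    and ghost_source: "e \<in> arcs G \<Longrightarrow> q [Ghost e, Vertex (tail G e)] = q [Ghost e]"
    and ghost_edge: "e \<in> arcs G \<Longrightarrow> q [Ghost e, Edge e] = q [Vertex (head G e)]"
    and ghost_edge_orth: "f \<noteq> e \<Longrightarrow> q [Ghost f, Edge e] = z"
begin

section \<open>Multiplication rules for words modulo the relations\<close>

lemma cong_Cons: "q u = q w \<Longrightarrow> q (g # u) = q (g # w)"
  using context_cong[of u w "[g]" "[]"] by simp

lemma cong_left: "q u = q w \<Longrightarrow> q (x @ u) = q (x @ w)"
  using context_cong[of u w x "[]"] by simp

lemma cong_right: "q u = q w \<Longrightarrow> q (u @ y) = q (w @ y)"
  using context_cong[of u w "[]" y] by simp

lemma zero_Cons: "q u = z \<Longrightarrow> q (g # u) = z"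
  using context_zero[of u "[g]" "[]"] by simp

lemma zero_left: "q u = z \<Longrightarrow> q (x @ u) = z"
  using context_zero[of u x "[]"] by simp

lemma zero_right: "q u = z \<Longrightarrow> q (u @ y) = z"
  using context_zero[of u "[]" y] by simp

lemma Vertex_Vertex: "q (Vertex v # Vertex v # w) = q (Vertex v # w)"
  using cong_right[OF vertex_idem, of v w] by simp

lemma Vertex_Vertex_orth: "u \<noteq> v \<Longrightarrow> q (Vertex u # Vertex v # w) = z"
  using zero_right[OF vertex_orth, of u v w] by simp

lemma Vertex_Edge: "e \<in> arcs G \<Longrightarrow> q (Vertex (tail G e) # Edge e # w) = q (Edge e # w)"
  using cong_right[OF source_edge, of e w] by simp

lemma Edge_Vertex: "e \<in> arcs G \<Longrightarrow> q (Edge e # Vertex (head G e) # w) = q (Edge e # w)"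
  using cong_right[OF edge_range, of e w] by simp

lemma Vertex_Ghost: "e \<in> arcs G \<Longrightarrow> q (Vertex (head G e) # Ghost e # w) = q (Ghost e # w)"
  using cong_right[OF range_ghost, of e w] by simp

lemma Ghost_Vertex: "e \<in> arcs G \<Longrightarrow> q (Ghost e # Vertex (tail G e) # w) = q (Ghost e # w)"
  using cong_right[OF ghost_source, of e w] by simp

lemma Ghost_Edge: "e \<in> arcs G \<Longrightarrow> q (Ghost e # Edge e # w) = q (Vertex (head G e) # w)"
  using cong_right[OF ghost_edge, of e w] by simp

lemma Ghost_Edge_orth: "f \<noteq> e \<Longrightarrow> q (Ghost f # Edge e # w) = z"
  using zero_right[OF ghost_edge_orth, of f e w] by simp

lemma foreign_Cons: "g \<notin> generators G \<Longrightarrow> q (g # w) = z"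
  using zero_right[OF foreign, of g w] by simp

lemma Edge_Vertex_orth: "v \<noteq> head G e \<Longrightarrow> q (Edge e # Vertex v # w) = z"
proof (cases "e \<in> arcs G")
  case True
  assume "v \<noteq> head G e"
  then show ?thesis
    using Edge_Vertex[OF True, of "Vertex v # w"]
      zero_Cons[OF Vertex_Vertex_orth[of "head G e" v w], of "Edge e"] by simp
qed (simp add: foreign_Cons generators_def image_iff)

lemma Ghost_Vertex_orth: "v \<noteq> tail G e \<Longrightarrow> q (Ghost e # Vertex v # w) = z"
proof (cases "e \<in> arcs G")
  case True
  assume "v \<noteq> tail G e"
  then show ?thesis
    using Ghost_Vertex[OF True, of "Vertex v # w"]
      zero_Cons[OF Vertex_Vertex_orth[of "tail G e" v w], of "Ghost e"] by simp
qed (simp add: foreign_Cons generators_def image_iff)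

lemma Vertex_path: "awalk u p v \<Longrightarrow> p \<noteq> [] \<Longrightarrow> q (Vertex u # path_word p @ w) = q (path_word p @ w)"
  by (cases p) (auto simp: awalk_simps Vertex_Edge)

lemma Vertex_path_Vertex:
  "awalk u p v \<Longrightarrow> q (Vertex u # path_word p @ Vertex v # w) = q (path_word p @ Vertex v # w)"
  by (cases p) (auto simp: awalk_simps Vertex_Edge Vertex_Vertex)

lemma path_Vertex: "awalk u p v \<Longrightarrow> p \<noteq> [] \<Longrightarrow> q (path_word p @ Vertex v # w) = q (path_word p @ w)"
proof (induction p arbitrary: u)
  case (Cons e p)
  show ?case
  proof (cases "p = []")
    case True
    with Cons.prems show ?thesis using Edge_Vertex[of e w] by (auto simp: awalk_simps)
  next
    case False
    with Cons have "q (path_word p @ Vertex v # w) = q (path_word p @ w)"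
      by (auto simp: awalk_simps)
    from cong_Cons[OF this, of "Edge e"] show ?thesis by simp
  qed
qed simp

lemma ghost_Vertex:
  assumes "awalk u p v" "p \<noteq> []"
  shows "q (ghost_word p @ Vertex u # w) = q (ghost_word p @ w)"
  using assms
  by (cases p) (auto simp: awalk_simps Ghost_Vertex intro!: cong_left)

lemma Vertex_ghost_Vertex:
  assumes "awalk u p v"
  shows "q (Vertex v # ghost_word p @ Vertex u # w) = q (Vertex v # ghost_word p @ w)"
proof (cases "p = []")
  case True
  with assms show ?thesis by (simp add: awalk_simps Vertex_Vertex)
next
  case False
  with assms show ?thesis by (intro cong_Cons ghost_Vertex)
qed

lemma ghost_path_Vertex:
  "awalk u p v \<Longrightarrow> q (ghost_word p @ path_word p @ Vertex v # w) = q (Vertex v # w)"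
proof (induction p arbitrary: u)
  case (Cons e p)
  then have e: "e \<in> arcs G" and p: "awalk (head G e) p v" by (auto simp: awalk_simps)
  have "q (ghost_word (e # p) @ path_word (e # p) @ Vertex v # w)
      = q (ghost_word p @ Vertex (head G e) # path_word p @ Vertex v # w)"
    using cong_left[OF Ghost_Edge[OF e]] by simp
  also have "\<dots> = q (ghost_word p @ path_word p @ Vertex v # w)"
    by (intro cong_left Vertex_path_Vertex p)
  finally show ?case using Cons.IH[OF p] by simp
qed simp

lemma Vertex_ghost_path:
  assumes "awalk u p v"
  shows "q (Vertex v # ghost_word p @ path_word p @ w) = q (Vertex v # w)"
proof (cases "p = []")
  case False
  have "q (Vertex v # ghost_word p @ path_word p @ w)
      = q (Vertex v # ghost_word p @ path_word p @ Vertex v # w)"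
    by (rule cong_Cons, rule cong_left, rule path_Vertex[symmetric, OF assms False])
  also have "\<dots> = q (Vertex v # Vertex v # w)"
    by (rule cong_Cons, rule ghost_path_Vertex[OF assms])
  finally show ?thesis by (simp add: Vertex_Vertex)
qed simp

text \<open>Multiplying by \<alpha>* on the left and by \<beta> on the right recovers the middle
  vertex, so it lies in every ideal that contains the element.\<close>

lemma normal_form_zero:
  assumes a: "awalk a \<alpha> u" and b: "awalk b \<beta> u"
    and zero: "q (path_word \<alpha> @ Vertex u # ghost_word \<beta>) = z"
  shows "q [Vertex u] = z"
proof -
  have "q (Vertex u # ghost_word \<beta>) = z"
    using zero_left[OF zero, of "ghost_word \<alpha>"] ghost_path_Vertex[OF a] by simp
  then show ?thesis
    using zero_right[of "Vertex u # ghost_word \<beta>" "path_word \<beta>"] Vertex_ghost_path[OF b, of "[]"]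
    by simp
qed

lemma normal_form_zero_iff:
  assumes a: "awalk a \<alpha> u" and b: "awalk b \<beta> u"
  shows "q (path_word \<alpha> @ Vertex u # ghost_word \<beta>) = z \<longleftrightarrow> q [Vertex u] = z"
  using normal_form_zero[OF a b] context_zero[of "[Vertex u]" "path_word \<alpha>" "ghost_word \<beta>"] by auto

section \<open>Reduction of words to normal form\<close>

lemma Ghost_normal_form:
  assumes "awalk a (e # \<alpha>) u"
  shows "q (Ghost e # path_word (e # \<alpha>) @ Vertex u # w) = q (path_word \<alpha> @ Vertex u # w)"
  using assms by (auto simp: awalk_simps Ghost_Edge Vertex_path_Vertex)

text \<open>The middle vertex is written even where it is redundant: paths of length zero then need
  no separate form, and the word is never empty.\<close>

definition has_normal_form :: "('v, 'e) generator list \<Rightarrow> bool" where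
  "has_normal_form w \<longleftrightarrow> (\<exists>a \<alpha> u b \<beta>. awalk a \<alpha> u \<and> awalk b \<beta> u \<and>
     q w = q (path_word \<alpha> @ Vertex u # ghost_word \<beta>))"

lemma has_normal_formI:
  "awalk a \<alpha> u \<Longrightarrow> awalk b \<beta> u \<Longrightarrow> q w = q (path_word \<alpha> @ Vertex u # ghost_word \<beta>)
   \<Longrightarrow> has_normal_form w"
  unfolding has_normal_form_def by (intro exI conjI)

text \<open>It suffices to multiply a normal form by one generator from the left. A ghost edge
  cancels against the first edge of \<alpha>, gives zero there, or, if \<alpha> is empty, joins the
  ghost part; as \<open>ghost_word\<close> reverses, it is then the last edge of \<beta>.\<close>

lemma normal_form_exists:
  assumes "w \<noteq> []"
  shows "q w = z \<or> has_normal_form w"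
  using assms
proof (induction w rule: list_nonempty_induct)
  case (single g)
  show ?case
  proof (cases "g \<in> generators G")
    case True
    then consider v where "g = Vertex v" "v \<in> verts G" | e where "g = Edge e" "e \<in> arcs G"
      | e where "g = Ghost e" "e \<in> arcs G" by (auto simp: generators_def)
    then show ?thesis
    proof cases
      case (1 v)
      then have "awalk v [] v" "q [g] = q (path_word [] @ Vertex v # ghost_word [])"
        by (simp_all add: awalk_simps)
      then show ?thesis by (intro disjI2 has_normal_formI)
    next
      case (2 e)
      then have "awalk (tail G e) [e] (head G e)" "awalk (head G e) [] (head G e)"
        "q [g] = q (path_word [e] @ Vertex (head G e) # ghost_word [])"
        by (auto simp: awalk_simps Edge_Vertex)
      then show ?thesis by (intro disjI2 has_normal_formI)
    next
      case (3 e)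
      then have "awalk (tail G e) [e] (head G e)" "awalk (head G e) [] (head G e)"
        "q [g] = q (path_word [] @ Vertex (head G e) # ghost_word [e])"
        by (auto simp: awalk_simps Vertex_Ghost)
      then show ?thesis by (intro disjI2 has_normal_formI)
    qed
  qed (simp add: foreign)
next
  case (cons g w)
  show ?case
  proof (cases "q w = z \<or> g \<notin> generators G")
    case True
    then show ?thesis using foreign_Cons zero_Cons by blast
  next
    case False
    with cons.IH obtain a \<alpha> u b \<beta> where a: "awalk a \<alpha> u" and b: "awalk b \<beta> u"
      and w: "q w = q (path_word \<alpha> @ Vertex u # ghost_word \<beta>)"
      unfolding has_normal_form_def by blast
    have gw: "q (g # w) = q (g # path_word \<alpha> @ Vertex u # ghost_word \<beta>)"
      by (rule cong_Cons[OF w])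
    have via_a: "q (g # w) = q (g # Vertex a # path_word \<alpha> @ Vertex u # ghost_word \<beta>)"
      unfolding gw by (rule cong_Cons, rule Vertex_path_Vertex[symmetric, OF a])
    from False consider v where "g = Vertex v" | e where "g = Edge e" "e \<in> arcs G"
      | e where "g = Ghost e" "e \<in> arcs G" by (auto simp: generators_def)
    then show ?thesis
    proof cases
      case (1 v)
      show ?thesis
      proof (cases "v = a")
        case True
        then have "q (g # w) = q w"
          using gw w 1 Vertex_path_Vertex[OF a] by simp
        then have "q (g # w) = q (path_word \<alpha> @ Vertex u # ghost_word \<beta>)" using w by simp
        with a b show ?thesis by (intro disjI2 has_normal_formI)
      qed (use via_a 1 Vertex_Vertex_orth in simp)
    next
      case (2 e)
      show ?thesis
      proof (cases "head G e = a")
        case True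
        then have "awalk (tail G e) (e # \<alpha>) u" using a 2 by (simp add: awalk_simps)
        moreover note b
        moreover have "q (g # w) = q (path_word (e # \<alpha>) @ Vertex u # ghost_word \<beta>)"
          using gw 2 by simp
        ultimately show ?thesis by (intro disjI2 has_normal_formI)
      qed (use via_a 2 Edge_Vertex_orth in simp)
    next
      case (3 e)
      show ?thesis
      proof (cases \<alpha>)
        case Nil
        with a have "a = u" by (simp add: awalk_simps)
        show ?thesis
        proof (cases "tail G e = u")
          case True
          have "q (g # w) = q (Ghost e # ghost_word \<beta>)"
            using gw Ghost_Vertex[of e] 3 Nil True by simp
          also have "\<dots> = q (path_word [] @ Vertex (head G e) # ghost_word (\<beta> @ [e]))"
            using Vertex_Ghost[of e] 3 by simp
          finally have eq: "q (g # w) = q (path_word [] @ Vertex (head G e) # ghost_word (\<beta> @ [e]))" .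
          have "awalk (head G e) [] (head G e)" "awalk b (\<beta> @ [e]) (head G e)"
            using b 3 True by (auto simp: awalk_append_ex_iff awalk_simps)
          then show ?thesis using eq by (intro disjI2 has_normal_formI)
        qed (use gw Nil 3 Ghost_Vertex_orth in simp)
      next
        case (Cons f \<alpha>')
        show ?thesis
        proof (cases "e = f")
          case True
          with 3 Cons have eq: "q (g # w) = q (path_word \<alpha>' @ Vertex u # ghost_word \<beta>)"
            using gw a Ghost_normal_form by simp
          have "awalk (head G f) \<alpha>' u" using a Cons by (simp add: awalk_simps)
          then show ?thesis using b eq by (intro disjI2 has_normal_formI)
        qed (use gw Cons 3 Ghost_Edge_orth in simp)
      qed
    qed
  qed
qed

end

section \<open>Comparison of two quotients\<close>

context inverse_quotient
begin

section \<open>Consequences of a loop relation and of equal normal forms\<close>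

lemma loop_first:
  assumes "awalk u (e # p) u" and loop: "q (path_word (e # p)) = q [Vertex u]"
  shows "q [Edge e, Ghost e] = q [Vertex u]"
proof -
  from assms have e: "e \<in> arcs G" "u = tail G e" by (auto simp: awalk_simps)
  have "q [Edge e, Ghost e] = q [Edge e, Ghost e, Vertex u]"
    using cong_Cons[OF ghost_source, of e "Edge e"] e by simp
  also have "\<dots> = q (Edge e # Ghost e # Edge e # path_word p)"
    using cong_left[OF loop, of "[Edge e, Ghost e]"] by simp
  also have "\<dots> = q (Edge e # Vertex (head G e) # path_word p)"
    by (rule cong_Cons, rule Ghost_Edge[OF e(1)])
  also have "\<dots> = q [Vertex u]"
    using loop by (simp add: Edge_Vertex e)
  finally show ?thesis .
qed

text \<open>Conjugation by e: r(e) = e*e = e*ue = e*(ep)e = pe.\<close>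

lemma loop_rotate:
  assumes walk: "awalk u (e # p) u" and loop: "q (path_word (e # p)) = q [Vertex u]"
  shows "q (path_word (p @ [e])) = q [Vertex (head G e)]"
proof -
  from walk have e: "e \<in> arcs G" "u = tail G e" and p: "awalk (head G e) p u"
    by (auto simp: awalk_simps)
  have "q [Vertex (head G e)] = q [Ghost e, Edge e]"
    by (simp add: ghost_edge e)
  also have "\<dots> = q [Ghost e, Vertex u, Edge e]"
    by (simp add: Ghost_Vertex e)
  also have "\<dots> = q (Ghost e # Edge e # path_word p @ [Edge e])"
    using context_cong[OF loop, of "[Ghost e]" "[Edge e]"] by simp
  also have "\<dots> = q (Vertex (head G e) # path_word (p @ [e]))"
    by (simp add: Ghost_Edge e)
  also have "\<dots> = q (path_word (p @ [e]))"
    using Vertex_path[of "head G e" "p @ [e]" "head G e" "[]"] p e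
    by (auto simp: awalk_append_ex_iff awalk_simps)
  finally show ?thesis by simp
qed

lemma loop_rotate_nonzero:
  assumes "awalk u (e # p) u" and loop: "q (path_word (e # p)) = q [Vertex u]"
    and "q [Vertex u] \<noteq> z"
  shows "q [Vertex (head G e)] \<noteq> z"
proof
  assume zero: "q [Vertex (head G e)] = z"
  from assms have "e \<in> arcs G" by (auto simp: awalk_simps)
  then have "q (path_word (e # p)) = z"
    using Edge_Vertex[of e "path_word p"] context_zero[OF zero, of "[Edge e]" "path_word p"] by simp
  with assms show False by simp
qed

text \<open>Rotation brings any edge of a loop to the front, where \<open>loop_first\<close>
  applies. The induction runs over the edges before \<open>e\<close>, with the loop and its base
  point arbitrary because each rotation changes both.\<close>

lemma loop_edge:
  assumes "awalk u p u" "q (path_word p) = q [Vertex u]" "q [Vertex u] \<noteq> z" "e \<in> set p"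
  shows "q [Edge e, Ghost e] = q [Vertex (tail G e)] \<and> q [Vertex (tail G e)] \<noteq> z"
proof -
  from assms(4) obtain xs ys where "p = xs @ e # ys" by (auto simp: in_set_conv_decomp)
  with assms(1-3) show ?thesis
  proof (induction xs arbitrary: p u ys)
    case Nil
    then have "u = tail G e" by (simp add: awalk_simps)
    with Nil loop_first[of u e ys] show ?case by simp
  next
    case (Cons x xs)
    then have p: "p = x # (xs @ e # ys)" by simp
    have "awalk (head G x) ((xs @ e # ys) @ [x]) (head G x)"
      using Cons.prems(1) unfolding p
      by (subst awalk_append_ex_iff) (auto simp: awalk_simps intro: head_in_verts)
    moreover have "q (path_word ((xs @ e # ys) @ [x])) = q [Vertex (head G x)]"
      using Cons.prems(1,2) unfolding p by (rule loop_rotate)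
    moreover have "q [Vertex (head G x)] \<noteq> z"
      using Cons.prems(1-3) unfolding p by (rule loop_rotate_nonzero)
    ultimately show ?case by (rule Cons.IH[of _ _ "ys @ [x]"]) simp
  qed
qed

lemma path_ghost:
  assumes "awalk u p v" "\<And>e. e \<in> set p \<Longrightarrow> q [Edge e, Ghost e] = q [Vertex (tail G e)]"
  shows "q (path_word p @ Vertex v # ghost_word p) = q [Vertex u]"
  using assms
proof (induction p arbitrary: u)
  case (Cons e p)
  then have e: "e \<in> arcs G" "u = tail G e" and p: "awalk (head G e) p v" by (auto simp: awalk_simps)
  have "q (path_word p @ Vertex v # ghost_word p) = q [Vertex (head G e)]"
    using p Cons.prems(2) by (intro Cons.IH) auto
  from context_cong[OF this, of "[Edge e]" "[Ghost e]"]
  have "q (path_word (e # p) @ Vertex v # ghost_word (e # p)) = q [Edge e, Vertex (head G e), Ghost e]"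
    by simp
  also have "\<dots> = q [Vertex u]"
    using Cons.prems(2)[of e] e by (simp add: Edge_Vertex)
  finally show ?case .
qed (simp add: awalk_simps)

text \<open>Left multiplication by e* keeps the first element nonzero, but annihilates the second
  one if it begins with another edge.\<close>

lemma normal_form_head_eq:
  assumes "awalk a (e # \<alpha>) u" "awalk b \<beta> u" "q [Vertex u] \<noteq> z"
    and eq: "q (path_word (e # \<alpha>) @ Vertex u # ghost_word \<beta>)
      = q (path_word (f # \<gamma>) @ Vertex w # ghost_word \<delta>)"
  shows "e = f"
proof (rule ccontr)
  assume "e \<noteq> f"
  from assms(1) have "awalk (head G e) \<alpha> u" by (simp add: awalk_simps)
  then have "q (path_word \<alpha> @ Vertex u # ghost_word \<beta>) \<noteq> z"
    using assms(2,3) by (simp add: normal_form_zero_iff)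
  moreover have "q (path_word \<alpha> @ Vertex u # ghost_word \<beta>) = z"
    using cong_Cons[OF eq, of "Ghost e"] Ghost_normal_form[OF assms(1)] Ghost_Edge_orth[OF \<open>e \<noteq> f\<close>]
    by simp
  ultimately show False by simp
qed

end

text \<open>Intended reading: \<open>q\<close> is the quotient by \<rho> and \<open>q'\<close> the
  quotient by the congruence that the triple of \<rho> generates. The last three assumptions ask
  only for vertices, single edges and closed walks that what holds in the coarse quotient holds in
  the fine one; \<open>word_zero\<close> and \<open>word_eq\<close> extend this to all
  words.\<close>

locale quotient_refinement =
  coarse: inverse_quotient G q z + fine: inverse_quotient G q' z'
  for G :: "('v, 'e) pre_digraph" and q :: "('v, 'e) generator list \<Rightarrow> 'a" and z
    and q' :: "('v, 'e) generator list \<Rightarrow> 'b" and z' +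
  assumes refines: "q' s = q' t \<Longrightarrow> q s = q t"
    and refines_zero: "q' s = z' \<Longrightarrow> q s = z"
    and vertex_zero: "q [Vertex v] = z \<Longrightarrow> q' [Vertex v] = z'"
    and index_one: "e \<in> arcs G \<Longrightarrow> q [Vertex (tail G e)] \<noteq> z \<Longrightarrow> q [Edge e, Ghost e] = q [Vertex (tail G e)]
      \<Longrightarrow> q' [Edge e, Ghost e] = q' [Vertex (tail G e)]"
    and loop: "coarse.awalk u p u \<Longrightarrow> p \<noteq> [] \<Longrightarrow> q [Vertex u] \<noteq> z \<Longrightarrow> q (path_word p) = q [Vertex u]
      \<Longrightarrow> q' (path_word p) = q' [Vertex u]"
begin

text \<open>Right multiplication by \<beta> turns \<beta>* = u into the loop relation \<beta> = u,
  which passes to the fine quotient. There \<beta>\<beta>* = u turns it back, because by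
  \<open>loop_edge\<close> every edge of the loop satisfies ee* = s(e).\<close>

lemma ghost_loop:
  assumes b: "coarse.awalk b \<beta> u" and nz: "q [Vertex u] \<noteq> z"
    and eq: "q (Vertex u # ghost_word \<beta>) = q [Vertex u]"
  shows "q' (Vertex u # ghost_word \<beta>) = q' [Vertex u]"
proof (cases "\<beta> = []")
  case False
  have closed: "b = u"
  proof (rule ccontr)
    assume "b \<noteq> u"
    then have "q (Vertex u # ghost_word \<beta>) = z"
      using coarse.Vertex_ghost_Vertex[OF b, of "[]"] coarse.cong_right[OF eq, of "[Vertex b]"]
        coarse.vertex_orth[of u b] by simp
    with eq nz show False by simp
  qed
  have "q (path_word \<beta>) = q (Vertex u # path_word \<beta>)"
    using coarse.Vertex_path[OF b False, of "[]"] closed by simp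
  also have "\<dots> = q [Vertex u]"
    using coarse.cong_right[OF eq, of "path_word \<beta>"] coarse.Vertex_ghost_path[OF b, of "[]"]
    by simp
  finally have path: "q (path_word \<beta>) = q [Vertex u]" .
  have path': "q' (path_word \<beta>) = q' [Vertex u]"
    using b closed False nz path by (intro loop) simp_all
  have "q' [Edge e, Ghost e] = q' [Vertex (tail G e)]" if "e \<in> set \<beta>" for e
  proof (rule index_one)
    show "e \<in> arcs G" using b that unfolding coarse.awalk_def by blast
  qed (use coarse.loop_edge[OF _ path nz that] b closed in simp_all)
  then have "q' (path_word \<beta> @ Vertex u # ghost_word \<beta>) = q' [Vertex u]"
    using b closed by (intro fine.path_ghost) auto
  moreover have "q' (path_word \<beta> @ Vertex u # ghost_word \<beta>) = q' (Vertex u # Vertex u # ghost_word \<beta>)"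
    using fine.cong_right[OF path', of "Vertex u # ghost_word \<beta>"] by simp
  ultimately show ?thesis by (simp add: fine.Vertex_Vertex)
qed simp

text \<open>The first edge of \<beta> is the last letter of \<open>ghost_word \<beta>\<close>, so
  right multiplication by it cancels. If \<delta> had another first edge, a nonzero element would
  become zero. Once one side is used up, \<open>ghost_loop\<close> finishes.\<close>

lemma ghost_eq:
  assumes "coarse.awalk b \<beta> u" "coarse.awalk d \<delta> u" "q [Vertex u] \<noteq> z"
    and "q (Vertex u # ghost_word \<beta>) = q (Vertex u # ghost_word \<delta>)"
  shows "q' (Vertex u # ghost_word \<beta>) = q' (Vertex u # ghost_word \<delta>)"
  using assms
proof (induction \<beta> arbitrary: b d \<delta>)
  case Nil
  then have "q (Vertex u # ghost_word \<delta>) = q [Vertex u]" by simp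
  from ghost_loop[OF Nil(2,3) this] show ?case by simp
next
  case (Cons e \<beta>)
  then have e: "e \<in> arcs G" and \<beta>: "coarse.awalk (head G e) \<beta> u" by (auto simp: coarse.awalk_simps)
  show ?case
  proof (cases \<delta>)
    case Nil
    with Cons.prems show ?thesis using ghost_loop[of b "e # \<beta>" u] by simp
  next
    case (Cons f \<delta>')
    with Cons.prems have f: "f \<in> arcs G" and \<delta>': "coarse.awalk (head G f) \<delta>' u"
      by (auto simp: coarse.awalk_simps)
    have left: "q ((Vertex u # ghost_word (e # \<beta>)) @ [Edge e]) = q (Vertex u # ghost_word \<beta>)"
      using coarse.cong_left[OF coarse.ghost_edge[OF e], of "Vertex u # ghost_word \<beta>"]
        coarse.Vertex_ghost_Vertex[OF \<beta>, of "[]"] by simp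
    note right = coarse.cong_right[OF Cons.prems(4), of "[Edge e]", unfolded left]
    have "e = f"
    proof (rule ccontr)
      assume "e \<noteq> f"
      then have "q (Vertex u # ghost_word \<beta>) = z"
        using right coarse.zero_left[OF coarse.ghost_edge_orth[of f e], of "Vertex u # ghost_word \<delta>'"]
        by (simp add: Cons)
      moreover have "coarse.awalk u [] u" using \<beta> by (auto simp: coarse.awalk_simps)
      ultimately show False
        using coarse.normal_form_zero[OF _ \<beta>, of u "[]"] Cons.prems(3) by simp
    qed
    have "q (Vertex u # ghost_word \<beta>) = q (Vertex u # ghost_word \<delta>')"
      using right coarse.cong_left[OF coarse.ghost_edge[OF f], of "Vertex u # ghost_word \<delta>'"]
        coarse.Vertex_ghost_Vertex[OF \<delta>', of "[]"] by (simp add: Cons \<open>e = f\<close>)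
    from fine.cong_right[OF Cons.IH[OF \<beta> \<delta>' Cons.prems(3) this], of "[Ghost e]"]
    show ?thesis by (simp add: Cons \<open>e = f\<close>)
  qed
qed

text \<open>
  A leading edge occurring on one side only is moved to the other side as a ghost edge; this is
  reversible modulo the finer congruence because its source must then be an index one vertex.
\<close>

lemma normal_form_step:
  assumes "\<alpha> \<noteq> []"
    and walks: "coarse.awalk a \<alpha> u" "coarse.awalk b \<beta> u" "coarse.awalk d \<delta> w"
    and nz: "q [Vertex u] \<noteq> z" "q [Vertex w] \<noteq> z"
    and eq: "q (path_word \<alpha> @ Vertex u # ghost_word \<beta>) = q (Vertex w # ghost_word \<delta>)"
    and IH: "\<And>a' \<alpha>' d' \<delta>' w'. length \<alpha>' < length \<alpha> \<Longrightarrow> coarse.awalk a' \<alpha>' u \<Longrightarrow> coarse.awalk w' [] w' \<Longrightarrow>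
      coarse.awalk d' \<delta>' w' \<Longrightarrow> q [Vertex w'] \<noteq> z \<Longrightarrow>
      q (path_word \<alpha>' @ Vertex u # ghost_word \<beta>) = q (Vertex w' # ghost_word \<delta>') \<Longrightarrow>
      q' (path_word \<alpha>' @ Vertex u # ghost_word \<beta>) = q' (Vertex w' # ghost_word \<delta>')"
  shows "q' (path_word \<alpha> @ Vertex u # ghost_word \<beta>) = q' (Vertex w # ghost_word \<delta>)"
proof -
  from \<open>\<alpha> \<noteq> []\<close> obtain e \<alpha>' where \<alpha>: "\<alpha> = e # \<alpha>'" by (cases \<alpha>) auto
  with walks have e: "e \<in> arcs G" and \<alpha>': "coarse.awalk (head G e) \<alpha>' u"
    by (auto simp: coarse.awalk_simps)
  have strip: "q (path_word \<alpha>' @ Vertex u # ghost_word \<beta>) = q (Ghost e # Vertex w # ghost_word \<delta>)"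
    using coarse.cong_Cons[OF eq, of "Ghost e"] coarse.Ghost_normal_form[of a e \<alpha>' u] walks(1)
    by (simp add: \<alpha>)
  have w: "w = tail G e"
    using coarse.Ghost_Vertex_orth[of w e "ghost_word \<delta>"] strip nz(1)
      coarse.normal_form_zero[OF \<alpha>' walks(2)] by auto
  \<comment> \<open>Multiplying \<open>strip\<close> by e restores the left side of
    \<open>eq\<close>, so ee* fixes w\<delta>*. Cancelling \<delta>* leaves the index one relation
    at w.\<close>
  have "q (Edge e # Ghost e # Vertex w # ghost_word \<delta>) = q (Vertex w # ghost_word \<delta>)"
    using coarse.cong_Cons[OF strip, of "Edge e"] eq by (simp add: \<alpha>)
  from coarse.cong_right[OF this, of "path_word \<delta>"]
  have "q [Edge e, Ghost e, Vertex w] = q [Vertex w]"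
    using coarse.cong_left[OF coarse.Vertex_ghost_path[OF walks(3), of "[]"], of "[Edge e, Ghost e]"]
      coarse.Vertex_ghost_path[OF walks(3), of "[]"] by simp
  then have "q [Edge e, Ghost e] = q [Vertex w]"
    using coarse.cong_Cons[OF coarse.ghost_source[OF e], of "Edge e"] w by simp
  then have index: "q' [Edge e, Ghost e] = q' [Vertex w]"
    using index_one[OF e] nz w by simp
  have "q (path_word \<alpha>' @ Vertex u # ghost_word \<beta>) = q (Vertex (head G e) # ghost_word (\<delta> @ [e]))"
    using strip w by (simp add: coarse.Ghost_Vertex coarse.Vertex_Ghost e)
  moreover have "coarse.awalk d (\<delta> @ [e]) (head G e)" "coarse.awalk (head G e) [] (head G e)"
    using walks(3) e w by (auto simp: coarse.awalk_append_ex_iff coarse.awalk_simps)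
  moreover have "q [Vertex (head G e)] \<noteq> z"
    using coarse.normal_form_zero[OF \<alpha>' walks(2)] nz(1) calculation(1)
      coarse.zero_right[of "[Vertex (head G e)]" "ghost_word (\<delta> @ [e])"] by auto
  ultimately have "q' (path_word \<alpha>' @ Vertex u # ghost_word \<beta>)
      = q' (Vertex (head G e) # ghost_word (\<delta> @ [e]))"
    using \<alpha>' walks(2) nz(1) \<alpha> by (intro IH) auto
  from fine.cong_Cons[OF this, of "Edge e"]
  have "q' (path_word \<alpha> @ Vertex u # ghost_word \<beta>) = q' (Edge e # Ghost e # ghost_word \<delta>)"
    by (simp add: \<alpha> fine.Edge_Vertex e)
  also have "\<dots> = q' (Vertex w # ghost_word \<delta>)"
    using fine.cong_right[OF index, of "ghost_word \<delta>"] by simp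
  finally show ?thesis .
qed

text \<open>The measure counts the leading paths only, since moving an edge across lengthens the
  ghost part of the other side. Two nonempty leading paths lose their common first edge; a single
  one is shortened by \<open>normal_form_step\<close>, which keeps the other one empty.\<close>

lemma normal_form_eq:
  assumes "coarse.awalk a \<alpha> u" "coarse.awalk b \<beta> u" "coarse.awalk c \<gamma> w" "coarse.awalk d \<delta> w"
    and "q [Vertex u] \<noteq> z" "q [Vertex w] \<noteq> z"
    and "q (path_word \<alpha> @ Vertex u # ghost_word \<beta>) = q (path_word \<gamma> @ Vertex w # ghost_word \<delta>)"
  shows "q' (path_word \<alpha> @ Vertex u # ghost_word \<beta>) = q' (path_word \<gamma> @ Vertex w # ghost_word \<delta>)"
  using assms
proof (induction "length \<alpha> + length \<gamma>" arbitrary: a \<alpha> u b \<beta> c \<gamma> w d \<delta> rule: less_induct)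
  case less
  show ?case
  proof (cases "\<alpha> = [] \<or> \<gamma> = []")
    case False
    then obtain e \<alpha>' f \<gamma>' where \<alpha>: "\<alpha> = e # \<alpha>'" and \<gamma>: "\<gamma> = f # \<gamma>'" by (meson neq_Nil_conv)
    have "e = f"
      using coarse.normal_form_head_eq[of a e \<alpha>' u b \<beta> f \<gamma>' w \<delta>] less.prems unfolding \<alpha> \<gamma> by blast
    have "q (path_word \<alpha>' @ Vertex u # ghost_word \<beta>) = q (path_word \<gamma>' @ Vertex w # ghost_word \<delta>)"
      using coarse.cong_Cons[OF less.prems(7), of "Ghost e"] less.prems(1,3)
        coarse.Ghost_normal_form[of a e \<alpha>' u] coarse.Ghost_normal_form[of c f \<gamma>' w]
      unfolding \<alpha> \<gamma> by (simp add: \<open>e = f\<close>)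
    moreover have "coarse.awalk (head G e) \<alpha>' u" "coarse.awalk (head G f) \<gamma>' w"
      using less.prems(1,3) unfolding \<alpha> \<gamma> by (simp_all add: coarse.awalk_simps)
    ultimately have "q' (path_word \<alpha>' @ Vertex u # ghost_word \<beta>)
        = q' (path_word \<gamma>' @ Vertex w # ghost_word \<delta>)"
      using less.prems(2,4,5,6) by (intro less.hyps) (auto simp: \<alpha> \<gamma>)
    from fine.cong_Cons[OF this, of "Edge e"] show ?thesis by (simp add: \<alpha> \<gamma> \<open>e = f\<close>)
  next
    case True
    then consider "\<alpha> = []" "\<gamma> = []" | "\<alpha> \<noteq> []" "\<gamma> = []" | "\<alpha> = []" "\<gamma> \<noteq> []" by blast
    then show ?thesis
    proof cases
      case 1
      have "u = w"
      proof (rule ccontr)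
        assume "u \<noteq> w"
        then have "q (Vertex u # ghost_word \<beta>) = z"
          using coarse.cong_Cons[OF less.prems(7), of "Vertex u"] 1 coarse.Vertex_Vertex_orth[of u w]
          by (simp add: coarse.Vertex_Vertex)
        then show False
          using coarse.normal_form_zero[OF less.prems(1,2)] less.prems(5) 1 by simp
      qed
      then show ?thesis using ghost_eq[of b \<beta> u d \<delta>] less.prems 1 by simp
    next
      case 2
      have "q' (path_word \<alpha> @ Vertex u # ghost_word \<beta>) = q' (Vertex w # ghost_word \<delta>)"
      proof (rule normal_form_step[OF 2(1) less.prems(1,2,4,5,6)])
        show "q (path_word \<alpha> @ Vertex u # ghost_word \<beta>) = q (Vertex w # ghost_word \<delta>)"
          using less.prems(7) 2 by simp
      qed (use less.hyps[of _ "[]"] less.prems(2,5) 2 in simp)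
      with 2 show ?thesis by simp
    next
      case 3
      have "q' (path_word \<gamma> @ Vertex w # ghost_word \<delta>) = q' (Vertex u # ghost_word \<beta>)"
      proof (rule normal_form_step[OF 3(2) less.prems(3,4,2,6,5)])
        show "q (path_word \<gamma> @ Vertex w # ghost_word \<delta>) = q (Vertex u # ghost_word \<beta>)"
          using less.prems(7) 3 by simp
      qed (use less.hyps[of _ "[]"] less.prems(4,6) 3 in simp)
      with 3 show ?thesis by simp
    qed
  qed
qed

text \<open>The normal form is computed in the fine quotient and stays valid in the coarse one.
  Vanishing thus becomes a question about the middle vertex, which \<open>vertex_zero\<close>
  settles.\<close>

lemma word_zero:
  assumes "s \<noteq> []" and zero: "q s = z"
  shows "q' s = z'"
proof (rule disjE[OF fine.normal_form_exists[OF assms(1)]])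
  assume "fine.has_normal_form s"
  then obtain a \<alpha> u b \<beta> where walks: "coarse.awalk a \<alpha> u" "coarse.awalk b \<beta> u"
    and s: "q' s = q' (path_word \<alpha> @ Vertex u # ghost_word \<beta>)"
    unfolding fine.has_normal_form_def by blast
  have "q [Vertex u] = z"
    using coarse.normal_form_zero[OF walks] refines[OF s] zero by simp
  then show ?thesis
    using vertex_zero fine.normal_form_zero_iff[OF walks] s by simp
qed

lemma word_eq:
  assumes "s \<noteq> []" "t \<noteq> []" and eq: "q s = q t"
  shows "q' s = q' t"
proof (cases "q s = z")
  case True
  with assms show ?thesis using word_zero by metis
next
  case False
  then have "fine.has_normal_form s" "fine.has_normal_form t"
    using fine.normal_form_exists[OF assms(1)] fine.normal_form_exists[OF assms(2)] refines_zero eq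
    by metis+
  then obtain a \<alpha> u b \<beta> c \<gamma> w d \<delta> where walks: "coarse.awalk a \<alpha> u" "coarse.awalk b \<beta> u"
      "coarse.awalk c \<gamma> w" "coarse.awalk d \<delta> w"
    and s: "q' s = q' (path_word \<alpha> @ Vertex u # ghost_word \<beta>)"
    and t: "q' t = q' (path_word \<gamma> @ Vertex w # ghost_word \<delta>)"
    unfolding fine.has_normal_form_def by blast
  have "q [Vertex u] \<noteq> z" "q [Vertex w] \<noteq> z"
    using False eq refines[OF s] refines[OF t] coarse.normal_form_zero_iff[OF walks(1,2)]
      coarse.normal_form_zero_iff[OF walks(3,4)] by auto
  then show ?thesis
    using normal_form_eq[OF walks] refines[OF s] refines[OF t] eq s t by simp
qed

end

section \<open>Generated congruences\<close>

lemma
  assumes "congruence_on S mul \<rho>"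
  shows congruence_on_equiv: "equiv S \<rho>"
    and congruence_on_left: "(a, b) \<in> \<rho> \<Longrightarrow> c \<in> S \<Longrightarrow> (mul c a, mul c b) \<in> \<rho>"
    and congruence_on_right: "(a, b) \<in> \<rho> \<Longrightarrow> c \<in> S \<Longrightarrow> (mul a c, mul b c) \<in> \<rho>"
  using assms unfolding congruence_on_def by auto

lemma generated_congruence_superset: "R \<subseteq> generated_congruence S mul R"
  unfolding generated_congruence_def by blast

lemma generated_congruence_least:
  "congruence_on S mul \<rho> \<Longrightarrow> R \<subseteq> \<rho> \<Longrightarrow> generated_congruence S mul R \<subseteq> \<rho>"
  unfolding generated_congruence_def by blast

lemma congruence_on_generated:
  assumes closed: "\<And>a b. a \<in> S \<Longrightarrow> b \<in> S \<Longrightarrow> mul a b \<in> S" and R: "R \<subseteq> S \<times> S"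
  shows "congruence_on S mul (generated_congruence S mul R)"
proof -
  \<comment> \<open>Some congruence must contain \<open>R\<close>; an intersection of the empty
    family would not be a relation on \<open>S\<close>.\<close>
  have full: "congruence_on S mul (S \<times> S)"
    unfolding congruence_on_def equiv_def refl_on_def sym_def trans_def using closed by auto
  have "equiv S (generated_congruence S mul R)"
  proof (rule equivI)
    show "generated_congruence S mul R \<subseteq> S \<times> S"
      using full R by (rule generated_congruence_least)
    show "refl_on S (generated_congruence S mul R)"
      unfolding generated_congruence_def refl_on_def congruence_on_def equiv_def by blast
    show "sym (generated_congruence S mul R)"
      unfolding generated_congruence_def sym_def congruence_on_def equiv_def by blast
    show "trans (generated_congruence S mul R)"
    proof (rule transI)
      fix a b c
      assume ab: "(a, b) \<in> generated_congruence S mul R" and bc: "(b, c) \<in> generated_congruence S mul R"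
      have "(a, c) \<in> \<rho>" if \<rho>: "congruence_on S mul \<rho>" "R \<subseteq> \<rho>" for \<rho>
      proof -
        have "trans \<rho>" using \<rho>(1) by (simp add: congruence_on_def equiv_def)
        moreover have "(a, b) \<in> \<rho>" "(b, c) \<in> \<rho>"
          using ab bc generated_congruence_least[OF \<rho>] by auto
        ultimately show ?thesis by (rule transD)
      qed
      then show "(a, c) \<in> generated_congruence S mul R"
        unfolding generated_congruence_def by blast
    qed
  qed
  moreover have "(mul c a, mul c b) \<in> generated_congruence S mul R"
      "(mul a c, mul b c) \<in> generated_congruence S mul R"
    if ab: "(a, b) \<in> generated_congruence S mul R" and c: "c \<in> S" for a b c
  proof -
    have "(mul c a, mul c b) \<in> \<rho> \<and> (mul a c, mul b c) \<in> \<rho>"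
      if \<rho>: "congruence_on S mul \<rho>" "R \<subseteq> \<rho>" for \<rho>
    proof -
      have "(a, b) \<in> \<rho>" using ab generated_congruence_least[OF \<rho>] by blast
      then show ?thesis using congruence_on_left[OF \<rho>(1)] congruence_on_right[OF \<rho>(1)] c by simp
    qed
    then show "(mul c a, mul c b) \<in> generated_congruence S mul R"
      "(mul a c, mul b c) \<in> generated_congruence S mul R"
      unfolding generated_congruence_def by simp_all
  qed
  ultimately show ?thesis
    unfolding congruence_on_def by blast
qed

section \<open>Words in the graph inverse semigroup\<close>

context wf_digraph
begin

lemma free0_mult_closed: "a \<in> free0 G \<Longrightarrow> b \<in> free0 G \<Longrightarrow> free0_mult a b \<in> free0 G"
  by (cases a; cases b) (auto simp: free0_def)

lemma inv_relations_subset: "inv_relations G \<subseteq> free0 G \<times> free0 G"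
proof (rule subrelI)
  fix a b
  assume "(a, b) \<in> inv_relations G"
  then show "(a, b) \<in> free0 G \<times> free0 G"
    by cases (auto simp: free0_def generators_def)
qed

lemma congruence_inv_cong: "congruence_on (free0 G) free0_mult (inv_cong G)"
  unfolding inv_cong_def by (intro congruence_on_generated free0_mult_closed inv_relations_subset)

lemma equiv_inv_cong: "equiv (free0 G) (inv_cong G)"
  by (rule congruence_on_equiv[OF congruence_inv_cong])

text \<open>Sending words with foreign letters to zero makes the product of values the value of the
  concatenation with no hypothesis on letters. The empty word has no value in \<open>Inv G\<close>,
  hence the nonemptiness assumptions that follow.\<close>

definition inv_value :: "('a, 'b) generator list \<Rightarrow> ('a, 'b) inv_elem" where
  "inv_value w = (if set w \<subseteq> generators G then inv_word G w else inv_zero G)"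

lemma Some_in_free0: "w \<noteq> [] \<Longrightarrow> set w \<subseteq> generators G \<Longrightarrow> Some w \<in> free0 G"
  by (simp add: free0_def)

lemma None_in_free0: "None \<in> free0 G"
  by (simp add: free0_def)

lemma inv_zero_in_Inv: "inv_zero G \<in> Inv G"
  unfolding inv_zero_def Inv_def by (intro quotientI None_in_free0)

lemma inv_value_in_Inv: "w \<noteq> [] \<Longrightarrow> inv_value w \<in> Inv G"
  unfolding inv_value_def inv_word_def using inv_zero_in_Inv
  by (auto simp: Inv_def intro: quotientI Some_in_free0)

lemma Inv_cases:
  assumes "a \<in> Inv G"
  obtains "a = inv_zero G" | w where "w \<noteq> []" "set w \<subseteq> generators G" "a = inv_value w"
  using assms unfolding Inv_def
proof (rule quotientE)
  fix x
  assume "a = inv_cong G `` {x}" "x \<in> free0 G"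
  then show thesis using that
    by (cases x) (auto simp: free0_def inv_zero_def inv_value_def inv_word_def)
qed

lemma inv_mult_zero:
  shows "w \<noteq> [] \<Longrightarrow> inv_mult G (inv_value w) (inv_zero G) = inv_zero G"
    and "w \<noteq> [] \<Longrightarrow> inv_mult G (inv_zero G) (inv_value w) = inv_zero G"
    and "inv_mult G (inv_zero G) (inv_zero G) = inv_zero G"
  using quotient_mult_class[OF congruence_inv_cong]
  by (auto simp: inv_mult_def inv_value_def inv_word_def inv_zero_def None_in_free0 Some_in_free0)

lemma inv_mult_value:
  assumes "s \<noteq> []" "t \<noteq> []"
  shows "inv_mult G (inv_value s) (inv_value t) = inv_value (s @ t)"
proof (cases "set s \<subseteq> generators G \<and> set t \<subseteq> generators G")
  case True
  with assms show ?thesis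
    using quotient_mult_class[OF congruence_inv_cong, of "Some s" "Some t"]
    by (simp add: inv_mult_def inv_value_def inv_word_def Some_in_free0)
next
  case False
  then have "inv_value s = inv_zero G \<or> inv_value t = inv_zero G" "inv_value (s @ t) = inv_zero G"
    by (auto simp: inv_value_def)
  with assms inv_mult_zero show ?thesis by auto
qed

lemma inv_mult_closed: "a \<in> Inv G \<Longrightarrow> b \<in> Inv G \<Longrightarrow> inv_mult G a b \<in> Inv G"
  by (elim Inv_cases) (simp_all add: inv_mult_zero inv_mult_value inv_zero_in_Inv inv_value_in_Inv)

lemma inv_relation_eq: "(a, b) \<in> inv_relations G \<Longrightarrow> inv_cong G `` {a} = inv_cong G `` {b}"
  using equiv_class_eq[OF equiv_inv_cong] generated_congruence_superset[of "inv_relations G"]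
  unfolding inv_cong_def by blast

lemma inv_value_foreign: "g \<notin> generators G \<Longrightarrow> inv_value [g] = inv_zero G"
  by (simp add: inv_value_def)

lemma inv_value_relations:
  shows "inv_value [Vertex v, Vertex v] = inv_value [Vertex v]"
    and "u \<noteq> v \<Longrightarrow> inv_value [Vertex u, Vertex v] = inv_zero G"
    and "e \<in> arcs G \<Longrightarrow> inv_value [Vertex (tail G e), Edge e] = inv_value [Edge e]"
    and "e \<in> arcs G \<Longrightarrow> inv_value [Edge e, Vertex (head G e)] = inv_value [Edge e]"
    and "e \<in> arcs G \<Longrightarrow> inv_value [Vertex (head G e), Ghost e] = inv_value [Ghost e]"
    and "e \<in> arcs G \<Longrightarrow> inv_value [Ghost e, Vertex (tail G e)] = inv_value [Ghost e]"
    and "e \<in> arcs G \<Longrightarrow> inv_value [Ghost e, Edge e] = inv_value [Vertex (head G e)]"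
    and "f \<noteq> e \<Longrightarrow> inv_value [Ghost f, Edge e] = inv_zero G"
  using inv_relation_eq[OF inv_relations.vertices[of v G v]]
    inv_relation_eq[OF inv_relations.vertices[of u G v]]
    inv_relation_eq[OF inv_relations.source_edge[of e G]]
    inv_relation_eq[OF inv_relations.edge_range[of e G]]
    inv_relation_eq[OF inv_relations.range_ghost[of e G]]
    inv_relation_eq[OF inv_relations.ghost_source[of e G]]
    inv_relation_eq[OF inv_relations.ghost_edge[of e G e]]
    inv_relation_eq[OF inv_relations.ghost_edge[of e G f]]
  by (auto simp: inv_value_def inv_word_def inv_zero_def generators_def image_iff)

lemma inv_vertex_value: "v \<in> verts G \<Longrightarrow> inv_vertex G v = inv_value [Vertex v]"
  by (simp add: inv_vertex_def inv_value_def generators_def)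

lemma inv_edge_ghost_value:
  "e \<in> arcs G \<Longrightarrow> inv_mult G (inv_edge G e) (inv_ghost G e) = inv_value [Edge e, Ghost e]"
  using inv_mult_value[of "[Edge e]" "[Ghost e]"]
  by (simp add: inv_edge_def inv_ghost_def inv_value_def generators_def)

lemma inv_path_value: "set p \<subseteq> arcs G \<Longrightarrow> inv_path G p = inv_value (path_word p)"
  by (auto simp: inv_path_def inv_value_def generators_def)

end

text \<open>Reconciles \<open>semigroup_power\<close>, which multiplies on the right, with
  \<open>replicate\<close>, which unfolds on the left.\<close>

lemma concat_replicate_commute: "concat (replicate m c) @ c = c @ concat (replicate m c)"
  by (induction m) auto

lemma (in wf_digraph) power_inv_path:
  assumes "set c \<subseteq> arcs G" "c \<noteq> []" "m \<ge> 1"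
  shows "semigroup_power (inv_mult G) (inv_path G c) m = inv_value (path_word (concat (replicate m c)))"
proof -
  \<comment> \<open>The iteration starts at the path itself, so n iterations give the power with
    exponent n + 1.\<close>
  have "((\<lambda>y. inv_mult G y (inv_path G c)) ^^ n) (inv_path G c)
      = inv_value (path_word (concat (replicate (Suc n) c)))" for n
  proof (induction n)
    case (Suc n)
    then show ?case
      using assms by (simp add: inv_path_value inv_mult_value flip: map_append)
        (simp add: concat_replicate_commute)
  qed (use assms in \<open>simp add: inv_path_value\<close>)
  from this[of "m - 1"] show ?thesis
    using assms(3) by (simp add: semigroup_power_def)
qed

section \<open>Closed walks through vertices of index one\<close>

context wf_digraph
begin

lemma out_edge_unique:
  assumes "out_degree G (tail G e) = 1" "e \<in> arcs G" "f \<in> arcs G" "tail G f = tail G e"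
  shows "f = e"
proof -
  obtain g where "out_arcs G (tail G e) = {g}"
    using assms(1) unfolding out_degree_def by (rule card_1_singletonE)
  then have "f \<in> {g}" "e \<in> {g}" using assms by (simp_all flip: \<open>out_arcs G (tail G e) = {g}\<close>)
  then show ?thesis by simp
qed

text \<open>At each source of \<open>p\<close> there is only one edge that \<open>p'\<close> can
  take next.\<close>

lemma walk_prefix:
  assumes "awalk u p v" "awalk u p' v'" "\<And>e. e \<in> set p \<Longrightarrow> out_degree G (tail G e) = 1"
    and "length p \<le> length p'"
  shows "\<exists>r. p' = p @ r"
  using assms
proof (induction p arbitrary: u p')
  case (Cons e p)
  then obtain f r where p': "p' = f # r" by (cases p') auto
  then have "f = e"
    using Cons.prems(1,2) by (intro out_edge_unique[OF Cons.prems(3)]) (auto simp: awalk_simps)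
  with p' Cons.prems have "\<exists>s. r = p @ s"
    by (intro Cons.IH[of "head G e"]) (auto simp: awalk_simps)
  with p' \<open>f = e\<close> show ?case by simp
qed simp

text \<open>The cycle is a shortest closed walk at \<open>u\<close> inside \<open>W\<close>. By
  minimality and \<open>walk_prefix\<close> it is a prefix of every such closed walk, and what
  remains is empty or again such a walk.\<close>

lemma closed_walk_power:
  assumes walk: "awalk u p u" "p \<noteq> []" and W: "tail G ` set p \<subseteq> W"
    and index: "\<And>v. v \<in> W \<Longrightarrow> out_degree G v = 1"
  obtains c k where "c \<in> cycles_in G W" "k \<ge> 1" "tail G (hd c) = u" "p = concat (replicate k c)"
proof -
  define closed where "closed = (\<lambda>c. awalk u c u \<and> c \<noteq> [] \<and> tail G ` set c \<subseteq> W)"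
  define c where "c = arg_min length closed"
  have "closed p" using walk W by (simp add: closed_def)
  then have c: "closed c" and least: "\<And>d. closed d \<Longrightarrow> length c \<le> length d"
    using arg_min_nat_lemma[of closed p length] by (auto simp: c_def)
  from c have c_walk: "awalk u c u" "c \<noteq> []" "tail G ` set c \<subseteq> W" by (auto simp: closed_def)
  have "distinct (map (tail G) c)"
  proof (rule ccontr)
    assume "\<not> distinct (map (tail G) c)"
    then obtain xs ys zs v where "map (tail G) c = xs @ [v] @ ys @ [v] @ zs"
      using not_distinct_decomp by blast
    then obtain as e bs f cs where dec: "c = as @ e # bs @ f # cs" and "tail G e = v" "tail G f = v"
      by (auto simp: append_eq_map_conv Cons_eq_map_conv map_eq_append_conv map_eq_Cons_conv)
    \<comment> \<open>Skipping the segment between two equal sources leaves a shorter closed walk,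
      against minimality.\<close>
    then have "awalk u (as @ f # cs) u"
      using c_walk(1) by (auto simp: awalk_append_ex_iff awalk_simps)
    then have "closed (as @ f # cs)" using c_walk dec by (auto simp: closed_def)
    from least[OF this] show False by (simp add: dec)
  qed
  moreover have hd: "tail G (hd c) = u"
    using c_walk by (cases c) (auto simp: awalk_simps)
  ultimately have "c \<in> cycles_in G W"
    using c_walk by (simp add: cycles_in_def cycle_iff_distinct_sources)
  moreover have "\<exists>k\<ge>1. d = concat (replicate k c)" if "closed d" for d
    using that
  proof (induction "length d" arbitrary: d rule: less_induct)
    case less
    have "\<exists>r. d = c @ r"
    proof (rule walk_prefix)
      show "awalk u c u" "awalk u d u" using c less.prems by (auto simp: closed_def)
      show "length c \<le> length d" by (rule least[OF less.prems])
    qed (use c_walk index in auto)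
    then obtain r where r: "d = c @ r" ..
    show ?case
    proof (cases "r = []")
      case True
      with r have "d = concat (replicate 1 c)" by simp
      then show ?thesis by blast
    next
      case False
      have "awalk u r u"
        using less.prems c_walk awlast_if_cas unfolding r closed_def
        by (metis awalk_append_iff awalk_def)
      with less.prems False have "closed r" by (auto simp: r closed_def)
      moreover have "length r < length d" using r c_walk by simp
      ultimately obtain k where "k \<ge> 1" "r = concat (replicate k c)" using less.hyps by blast
      then have "d = concat (replicate (Suc k) c)" using r by simp
      then show ?thesis by (metis le_add1 plus_1_eq_Suc)
    qed
  qed
  ultimately show thesis using that hd \<open>closed p\<close> by blast
qed

end

lemma remove_hereditary_simps [simp]:
  "verts (remove_hereditary G H) = verts G - H"
  "arcs (remove_hereditary G H) = {e \<in> arcs G. head G e \<notin> H}"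
  "tail (remove_hereditary G H) = tail G"
  "head (remove_hereditary G H) = head G"
  by (simp_all add: remove_hereditary_def)

lemma (in wf_digraph) wf_remove_hereditary:
  assumes "hereditary G H"
  shows "wf_digraph (remove_hereditary G H)"
  using assms by unfold_locales (auto simp: hereditary_def)

text \<open>A walk that enters \<open>H\<close> never leaves it, so testing the last vertex is
  enough.\<close>

lemma (in wf_digraph) awalk_remove_hereditary:
  assumes H: "hereditary G H"
  shows "pre_digraph.awalk (remove_hereditary G H) u p v \<longleftrightarrow> awalk u p v \<and> v \<notin> H"
proof -
  interpret R: wf_digraph "remove_hereditary G H" by (rule wf_remove_hereditary[OF H])
  show ?thesis
  proof (induction p arbitrary: u)
    case (Cons e p)
    have "head G e \<notin> H" if "awalk (head G e) p v" "v \<notin> H"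
    proof -
      have "v \<in> H" if "awalk x p v" "x \<in> H" for x
        using that H by (induction p arbitrary: x) (auto simp: awalk_simps hereditary_def)
      with that show ?thesis by blast
    qed
    with Cons show ?case by (auto simp: awalk_simps R.awalk_simps)
  qed (auto simp: awalk_simps R.awalk_simps)
qed

section \<open>The triple of a congruence\<close>

lemma (in wf_digraph) cycles_in_rotate1:
  assumes "c \<in> cycles_in G W"
  shows "rotate1 c \<in> cycles_in G W"
proof -
  from assms have c: "c \<noteq> []" "awalk (tail G (hd c)) c (tail G (hd c))" "distinct (map (tail G) c)"
    "tail G ` set c \<subseteq> W" by (auto simp: cycles_in_def cycle_iff_distinct_sources)
  then obtain e p where p: "c = e # p" by (cases c) auto
  have e: "e \<in> arcs G" and walk: "awalk (head G e) p (tail G e)"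
    using c(2) by (simp_all add: p awalk_simps)
  have "awalk (head G e) (p @ [e]) (head G e)"
    using e walk by (subst awalk_append_ex_iff) (auto simp: awalk_simps)
  moreover have "tail G (hd (p @ [e])) = head G e"
    using walk by (cases p) (auto simp: awalk_simps)
  ultimately show ?thesis
    using c(3,4) by (simp add: p cycles_in_def cycle_iff_distinct_sources)
qed

lemma (in wf_digraph) cycles_in_rotate: "c \<in> cycles_in G W \<Longrightarrow> rotate n c \<in> cycles_in G W"
  by (induction n) (auto intro: cycles_in_rotate1)

lemma rotate_inverse: "\<exists>k. rotate k (rotate n c) = c"
proof (cases "c = []")
  case False
  \<comment> \<open>The complementary rotation: the two add up to a multiple of the length. The
    subtraction is not truncated because c is nonempty.\<close>
  then have "n * length c - n + n = n * length c" by (cases c) auto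
  then have "rotate (n * length c - n) (rotate n c) = rotate (n * length c) c"
    by (simp add: rotate_rotate)
  also have "\<dots> = c" by (subst rotate_conv_mod) simp
  finally show ?thesis by blast
qed simp

lemma concat_replicate_rotate:
  "concat (replicate m (e # p)) @ [e] = e # concat (replicate m (p @ [e]))"
  by (induction m) auto

lemma concat_replicate_add:
  "concat (replicate (m + n) c) = concat (replicate m c) @ concat (replicate n c)"
  by (simp add: replicate_add)

lemma concat_replicate_mult:
  "concat (replicate (n * m) c) = concat (replicate n (concat (replicate m c)))"
  by (induction n) (simp_all add: replicate_add)

lemma (in wf_digraph) awalk_power: "awalk u c u \<Longrightarrow> awalk u (concat (replicate m c)) u"
proof (induction m)
  case (Suc m)
  then show ?case unfolding replicate_Suc concat.simps awalk_append_ex_iff by blast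
qed (auto simp: awalk_simps)

section \<open>Zero vertices, index one edges and exponents of cycles in a quotient\<close>

context inverse_quotient
begin

lemma hereditary_zero: "hereditary G {v \<in> verts G. q [Vertex v] = z}"
proof -
  have "q [Vertex (head G e)] = z" if e: "e \<in> arcs G" and zero: "q [Vertex (tail G e)] = z" for e
  proof -
    have "q [Edge e] = z"
      using zero_right[OF zero, of "[Edge e]"] source_edge[OF e] by simp
    from zero_left[OF this, of "[Ghost e]"] show ?thesis
      using ghost_edge[OF e] by simp
  qed
  then show ?thesis by (auto simp: hereditary_def)
qed

text \<open>If f differs from e, then f = s(e)f = ee*f = 0, and so r(f) = f*f = 0.\<close>

lemma index_edge_unique:
  assumes "e \<in> arcs G" "f \<in> arcs G" "tail G f = tail G e"
    and index: "q [Edge e, Ghost e] = q [Vertex (tail G e)]" and nz: "q [Vertex (head G f)] \<noteq> z"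
  shows "f = e"
proof (rule ccontr)
  assume "f \<noteq> e"
  have "q [Edge f] = q [Edge e, Ghost e, Edge f]"
    using cong_right[OF index, of "[Edge f]"] source_edge[of f] assms(2,3) by simp
  also have "\<dots> = z"
    using zero_Cons[OF ghost_edge_orth[of e f], of "Edge e"] \<open>f \<noteq> e\<close> by simp
  finally have "q [Ghost f, Edge f] = z" by (rule zero_Cons)
  then show False using nz ghost_edge[of f] assms(2) by simp
qed

text \<open>From s(e) = ee* = e r(e) e*, a zero range would make the source zero.\<close>

lemma head_nonzero:
  assumes "e \<in> arcs G" "q [Edge e, Ghost e] = q [Vertex (tail G e)]" "q [Vertex (tail G e)] \<noteq> z"
  shows "q [Vertex (head G e)] \<noteq> z"
proof
  assume zero: "q [Vertex (head G e)] = z"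
  then show False
    using context_zero[OF zero, of "[Edge e]" "[Ghost e]"] assms Edge_Vertex[of e "[Ghost e]"] by simp
qed

definition loop_power :: "'e list \<Rightarrow> nat \<Rightarrow> bool" where
  "loop_power c m \<longleftrightarrow> m \<ge> 1 \<and> q (path_word (concat (replicate m c))) = q [Vertex (tail G (hd c))]"

text \<open>The leading vertex covers d = 0: the power is then the empty word, which does not
  represent the vertex.\<close>

lemma power_loop:
  assumes "q (path_word c) = q [Vertex u]"
  shows "q (Vertex u # path_word (concat (replicate d c)) @ x) = q (Vertex u # x)"
proof (induction d)
  case (Suc d)
  have "q (Vertex u # path_word (concat (replicate (Suc d) c)) @ x)
      = q (Vertex u # Vertex u # path_word (concat (replicate d c)) @ x)"
    using context_cong[OF assms, of "[Vertex u]" "path_word (concat (replicate d c)) @ x"] by simp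
  also have "\<dots> = q (Vertex u # path_word (concat (replicate d c)) @ x)"
    by (rule Vertex_Vertex)
  finally show ?case using Suc.IH by simp
qed simp

lemma Vertex_path_power:
  assumes "awalk u c u" "c \<noteq> []" "m \<ge> 1"
  shows "q (Vertex u # path_word (concat (replicate m c))) = q (path_word (concat (replicate m c)))"
  using Vertex_path[OF awalk_power[OF assms(1), of m], of "[]"] assms(2,3) by simp

lemma loop_power_Least_dvd:
  assumes c: "awalk (tail G (hd c)) c (tail G (hd c))" "c \<noteq> []" and k: "loop_power c k"
  shows "(LEAST m. loop_power c m) dvd k"
proof (rule ccontr)
  define m where "m = (LEAST m. loop_power c m)"
  let ?u = "tail G (hd c)"
  assume "\<not> (LEAST m. loop_power c m) dvd k"
  then have r: "k mod m \<ge> 1" by (simp add: m_def dvd_eq_mod_eq_0)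
  have "loop_power c m" unfolding m_def by (rule LeastI[of "loop_power c", OF k])
  then have m: "m \<ge> 1" "q (path_word (concat (replicate m c))) = q [Vertex ?u]"
    by (simp_all add: loop_power_def)
  have "concat (replicate k c) = concat (replicate (k div m) (concat (replicate m c)))
      @ concat (replicate (k mod m) c)"
    by (subst div_mult_mod_eq[of k m, symmetric]) (simp only: concat_replicate_add concat_replicate_mult)
  then have "q (Vertex ?u # path_word (concat (replicate k c)))
      = q (Vertex ?u # path_word (concat (replicate (k mod m) c)))"
    using power_loop[OF m(2)] by simp
  then have "q (path_word (concat (replicate (k mod m) c))) = q [Vertex ?u]"
    using k Vertex_path_power[OF c] r by (simp add: loop_power_def)
  with r have "loop_power c (k mod m)" by (simp add: loop_power_def)
  moreover have "k mod m < m" using m(1) by simp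
  ultimately show False using not_less_Least unfolding m_def by blast
qed

text \<open>\<open>loop_rotate\<close> is applied to the whole closed walk c^m, and moving its first
  edge to the end gives the m-th power of the rotated cycle.\<close>

lemma loop_power_rotate1:
  assumes c: "awalk (tail G (hd c)) c (tail G (hd c))" "c \<noteq> []" and m: "loop_power c m"
  shows "loop_power (rotate1 c) m"
proof -
  from c(2) obtain e p where p: "c = e # p" by (cases c) auto
  from m obtain r where r: "concat (replicate m c) = e # r"
    by (cases m) (auto simp: loop_power_def p)
  have "q (path_word (r @ [e])) = q [Vertex (head G e)]"
  proof (rule loop_rotate)
    show "awalk (tail G e) (e # r) (tail G e)"
      using awalk_power[OF c(1), of m] r by (simp add: p)
    show "q (path_word (e # r)) = q [Vertex (tail G e)]"
      using m r by (simp add: p loop_power_def)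
  qed
  moreover have "r @ [e] = concat (replicate m (rotate1 c))"
    using concat_replicate_rotate[of m e p] r by (simp add: p)
  moreover have "tail G (hd (rotate1 c)) = head G e"
    using c(1) by (cases p) (auto simp: p awalk_simps)
  ultimately show ?thesis using m by (simp add: loop_power_def)
qed

end

section \<open>The quotient map and the triple of a congruence\<close>

locale inv_congruence = wf_digraph G for G :: "('v, 'e) pre_digraph" +
  fixes \<rho> :: "(('v, 'e) inv_elem \<times> ('v, 'e) inv_elem) set"
  assumes congruence: "congruence_on (Inv G) (inv_mult G) \<rho>"
begin

text \<open>Classes of elements are nonempty, so the value \<open>{}\<close> separates the empty
  word from all other words, as \<open>context_cong\<close> requires.\<close>

definition quotient :: "('v, 'e) generator list \<Rightarrow> ('v, 'e) inv_elem set" where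
  "quotient w = (if w = [] then {} else \<rho> `` {inv_value w})"

abbreviation zero_class :: "('v, 'e) inv_elem set" where
  "zero_class \<equiv> \<rho> `` {inv_zero G}"

lemma quotient_eq_iff:
  "s \<noteq> [] \<Longrightarrow> t \<noteq> [] \<Longrightarrow> quotient s = quotient t \<longleftrightarrow> (inv_value s, inv_value t) \<in> \<rho>"
  using eq_equiv_class_iff[OF congruence_on_equiv[OF congruence]]
  by (simp add: quotient_def inv_value_in_Inv)

lemma quotient_zero_iff: "s \<noteq> [] \<Longrightarrow> quotient s = zero_class \<longleftrightarrow> (inv_value s, inv_zero G) \<in> \<rho>"
  using eq_equiv_class_iff[OF congruence_on_equiv[OF congruence]]
  by (simp add: quotient_def inv_value_in_Inv inv_zero_in_Inv)

lemma class_nonempty: "a \<in> Inv G \<Longrightarrow> \<rho> `` {a} \<noteq> {}"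
  using equiv_class_self[OF congruence_on_equiv[OF congruence]] by blast

lemma quotient_Nil_iff: "quotient s = {} \<longleftrightarrow> s = []"
  using class_nonempty[OF inv_value_in_Inv] by (simp add: quotient_def)

lemma quotient_Cons_neq_Nil: "s \<noteq> [] \<Longrightarrow> quotient s \<noteq> quotient []"
  using quotient_Nil_iff[of s] by (simp add: quotient_def)

lemma rel_append_left:
  "(inv_value s, inv_value t) \<in> \<rho> \<Longrightarrow> s \<noteq> [] \<Longrightarrow> t \<noteq> [] \<Longrightarrow> (inv_value (x @ s), inv_value (x @ t)) \<in> \<rho>"
  using congruence_on_left[OF congruence _ inv_value_in_Inv[of x]]
  by (cases "x = []") (auto simp flip: inv_mult_value)

lemma rel_append_right:
  "(inv_value s, inv_value t) \<in> \<rho> \<Longrightarrow> s \<noteq> [] \<Longrightarrow> t \<noteq> [] \<Longrightarrow> (inv_value (s @ y), inv_value (t @ y)) \<in> \<rho>"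
  using congruence_on_right[OF congruence _ inv_value_in_Inv[of y]]
  by (cases "y = []") (auto simp flip: inv_mult_value)

lemma rel_append_zero:
  assumes "(inv_value s, inv_zero G) \<in> \<rho>" "s \<noteq> []"
  shows "(inv_value (x @ s @ y), inv_zero G) \<in> \<rho>"
proof -
  have "(inv_value (s @ y), inv_zero G) \<in> \<rho>"
    using assms congruence_on_right[OF congruence assms(1) inv_value_in_Inv[of y]]
    by (cases "y = []") (auto simp: inv_mult_value inv_mult_zero)
  from this congruence_on_left[OF congruence this inv_value_in_Inv[of x]] show ?thesis
    using assms(2) by (cases "x = []") (auto simp: inv_mult_value inv_mult_zero)
qed

lemma quotient_relation:
  "inv_value s = inv_value t \<Longrightarrow> s \<noteq> [] \<Longrightarrow> t \<noteq> [] \<Longrightarrow> quotient s = quotient t"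
  by (simp add: quotient_def)

lemma quotient_relation_zero: "inv_value s = inv_zero G \<Longrightarrow> s \<noteq> [] \<Longrightarrow> quotient s = zero_class"
  by (simp add: quotient_def)

sublocale inverse_quotient G quotient zero_class
proof unfold_locales
  fix s t x y
  assume eq: "quotient s = quotient t"
  show "quotient (x @ s @ y) = quotient (x @ t @ y)"
  proof (cases "s = []")
    case True
    with eq quotient_Cons_neq_Nil[of t] show ?thesis by metis
  next
    case False
    with eq quotient_Cons_neq_Nil[of s] have "t \<noteq> []" by metis
    with False eq have "(inv_value (s @ y), inv_value (t @ y)) \<in> \<rho>"
      by (intro rel_append_right) (simp_all add: quotient_eq_iff)
    with False \<open>t \<noteq> []\<close> show ?thesis
      by (subst quotient_eq_iff) (simp_all add: rel_append_left)
  qed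
next
  fix s x y
  assume zero: "quotient s = zero_class"
  have "s \<noteq> []" using zero class_nonempty[OF inv_zero_in_Inv] by (auto simp: quotient_def)
  with zero show "quotient (x @ s @ y) = zero_class"
    by (simp add: quotient_zero_iff rel_append_zero)
qed (rule quotient_relation quotient_relation_zero; simp add: inv_value_foreign inv_value_relations)+

lemma T_vertices_eq: "T_vertices G \<rho> = {v \<in> verts G. quotient [Vertex v] = zero_class}"
  by (auto simp: T_vertices_def quotient_zero_iff inv_vertex_value)

lemma vertex_nonzero_in_verts: "quotient [Vertex v] \<noteq> zero_class \<Longrightarrow> v \<in> verts G"
  using foreign[of "Vertex v"] by (auto simp: generators_def)

lemma vertex_nonzero_iff: "quotient [Vertex v] \<noteq> zero_class \<longleftrightarrow> v \<in> verts G - T_vertices G \<rho>"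
  using vertex_nonzero_in_verts by (auto simp: T_vertices_eq)

lemma T_hereditary: "hereditary G (T_vertices G \<rho>)"
  unfolding T_vertices_eq by (rule hereditary_zero)

text \<open>The witness may be sought among all edges of \<open>G\<close>: by
  \<open>head_nonzero\<close> its range is automatically outside the removed set.\<close>

lemma T_index_one_iff:
  "v \<in> T_index_one G \<rho> \<longleftrightarrow> quotient [Vertex v] \<noteq> zero_class \<and>
     (\<exists>e \<in> arcs G. tail G e = v \<and> quotient [Edge e, Ghost e] = quotient [Vertex v])"
proof -
  have rel: "(inv_mult G (inv_edge G e) (inv_ghost G e), inv_vertex G v) \<in> \<rho> \<longleftrightarrow>
      quotient [Edge e, Ghost e] = quotient [Vertex v]" if "e \<in> arcs G" "v \<in> verts G" for e
    using that by (simp add: inv_edge_ghost_value inv_vertex_value quotient_eq_iff)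
  have "head G e \<notin> T_vertices G \<rho>"
    if "e \<in> arcs G" "tail G e \<in> verts G - T_vertices G \<rho>"
      "quotient [Edge e, Ghost e] = quotient [Vertex (tail G e)]" for e
    using head_nonzero[OF that(1,3)] that(2) vertex_nonzero_iff by blast
  with rel show ?thesis
    unfolding T_index_one_def vertex_nonzero_iff by fastforce
qed

lemma cycles_in_remove_hereditaryD:
  assumes "hereditary G H" "c \<in> cycles_in (remove_hereditary G H) W"
  shows "c \<noteq> []" "awalk (tail G (hd c)) c (tail G (hd c))" "set c \<subseteq> arcs G" "tail G ` set c \<subseteq> W"
    "tail G (hd c) \<in> W" "tail G (hd c) \<in> verts G"
proof -
  show c: "c \<noteq> []" and walk: "awalk (tail G (hd c)) c (tail G (hd c))" and W: "tail G ` set c \<subseteq> W"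
    using assms by (auto simp: cycles_in_def cycle_iff_distinct_sources awalk_remove_hereditary)
  show "set c \<subseteq> arcs G" "tail G (hd c) \<in> verts G" using walk by (auto simp: awalk_def)
  show "tail G (hd c) \<in> W" using c W by auto
qed

lemma quotient_power_eq_iff:
  assumes "c \<noteq> []" "m \<ge> 1"
  shows "quotient (path_word (concat (replicate m c))) = quotient [Vertex u] \<longleftrightarrow>
     (inv_value (path_word (concat (replicate m c))), inv_value [Vertex u]) \<in> \<rho>"
proof (rule quotient_eq_iff)
  show "path_word (concat (replicate m c)) \<noteq> []" using assms by auto
qed simp

lemma loop_power_iff:
  "c \<noteq> [] \<Longrightarrow> loop_power c m \<longleftrightarrow> m \<ge> 1 \<and>
     (inv_value (path_word (concat (replicate m c))), inv_value [Vertex (tail G (hd c))]) \<in> \<rho>"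
  using quotient_power_eq_iff by (auto simp: loop_power_def)

lemma T_exponent_eq:
  "T_exponent G \<rho> = (\<lambda>c \<in> cycles_in (remove_hereditary G (T_vertices G \<rho>)) (T_index_one G \<rho>).
     if \<exists>m. loop_power c m then enat (LEAST m. loop_power c m) else \<infinity>)"
  unfolding T_exponent_def
proof (rule restrict_ext)
  fix c
  assume "c \<in> cycles_in (remove_hereditary G (T_vertices G \<rho>)) (T_index_one G \<rho>)"
  note c = cycles_in_remove_hereditaryD[OF T_hereditary this]
  have "(\<lambda>m. m \<ge> 1 \<and> (semigroup_power (inv_mult G) (inv_path G c) m, inv_vertex G (tail G (hd c))) \<in> \<rho>)
      = loop_power c"
    using c by (auto simp: fun_eq_iff loop_power_iff power_inv_path inv_vertex_value)
  then show "(let P = (\<lambda>m. m \<ge> 1 \<and>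
       (semigroup_power (inv_mult G) (inv_path G c) m, inv_vertex G (tail G (hd c))) \<in> \<rho>)
     in if \<exists>m. P m then enat (LEAST m. P m) else \<infinity>)
     = (if \<exists>m. loop_power c m then enat (LEAST m. loop_power c m) else \<infinity>)"
    by (simp only: Let_def)
qed

lemma T_map_in_triples: "T_map G \<rho> \<in> congruence_triples G"
proof -
  let ?H = "T_vertices G \<rho>" and ?W = "T_index_one G \<rho>" and ?f = "T_exponent G \<rho>"
  let ?R = "remove_hereditary G ?H"
  interpret R: wf_digraph ?R by (rule wf_remove_hereditary[OF T_hereditary])
  have "out_degree ?R v = 1" if v: "v \<in> ?W" for v
  proof -
    from v obtain e where nz: "quotient [Vertex v] \<noteq> zero_class" and e: "e \<in> arcs G" "tail G e = v"
      and index: "quotient [Edge e, Ghost e] = quotient [Vertex v]" by (auto simp: T_index_one_iff)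
    have "f = e" if "f \<in> arcs G" "tail G f = v" "head G f \<notin> ?H" for f
      using that e index index_edge_unique[of e f] vertex_nonzero_iff[of "head G f"] by auto
    moreover have "head G e \<notin> ?H"
      using head_nonzero[OF e(1), unfolded e(2), OF index nz] vertex_nonzero_iff by blast
    ultimately have "out_arcs ?R v = {e}" using e
      unfolding out_arcs_def remove_hereditary_simps by blast
    then show ?thesis by (simp add: out_degree_def)
  qed
  moreover have "?W \<subseteq> verts ?R" by (auto simp: T_index_one_def)
  moreover have "?f \<in> cycles_in ?R ?W \<rightarrow>\<^sub>E {0<..}"
  proof -
    have "0 < (LEAST m. loop_power c m)" if "loop_power c m" for c m
      using LeastI[of "loop_power c", OF that] by (simp add: loop_power_def)
    then show ?thesis unfolding T_exponent_eq by (auto simp: zero_enat_def)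
  qed
  moreover have "?f (rotate n c) = ?f c" if c: "c \<in> cycles_in ?R ?W" for c n
  proof -
    have rotate: "loop_power (rotate n c) m" if "c \<in> cycles_in ?R ?W" "loop_power c m" for n c m
    proof (induction n)
      case (Suc n)
      have "rotate n c \<in> cycles_in ?R ?W" using that(1) by (rule R.cycles_in_rotate)
      from loop_power_rotate1[OF cycles_in_remove_hereditaryD(2,1)[OF T_hereditary this] Suc]
      show ?case by simp
    qed (use that in simp)
    obtain k where "rotate k (rotate n c) = c" using rotate_inverse by blast
    \<comment> \<open>One implication for all rotations suffices, because a rotation is undone by a
      further rotation.\<close>
    have "loop_power (rotate n c) = loop_power c"
    proof (intro ext iffI)
      show "loop_power c m" if "loop_power (rotate n c) m" for m
        using rotate[OF R.cycles_in_rotate[OF c] that, of k] \<open>rotate k (rotate n c) = c\<close> by simp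
    qed (rule rotate[OF c])
    then show ?thesis using c R.cycles_in_rotate[OF c] by (simp add: T_exponent_eq)
  qed
  ultimately show ?thesis
    using T_hereditary by (auto simp: T_map_def congruence_triples_def congruence_pair_def)
qed

end

section \<open>The generating pairs expressed by words\<close>

context wf_digraph
begin

lemma wp_pairs_value:
  assumes "(H, W, f) \<in> congruence_triples G"
  shows "wp_pairs G (H, W, f) =
     {(inv_value [Vertex v], inv_zero G) | v. v \<in> H} \<union>
     {(inv_value [Edge e, Ghost e], inv_value [Vertex (tail G e)]) | e.
        e \<in> arcs G \<and> head G e \<notin> H \<and> tail G e \<in> W} \<union>
     {(inv_value (path_word (concat (replicate m c))), inv_value [Vertex (tail G (hd c))]) | c m.
        c \<in> cycles_in (remove_hereditary G H) W \<and> f c = enat m}"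
proof -
  let ?C = "cycles_in (remove_hereditary G H) W"
  from assms have H: "hereditary G H" and W: "W \<subseteq> verts G" and f: "f \<in> ?C \<rightarrow>\<^sub>E {0<..}"
    by (auto simp: congruence_triples_def congruence_pair_def)
  have 1: "{(inv_vertex G v, inv_zero G) | v. v \<in> H} = {(inv_value [Vertex v], inv_zero G) | v. v \<in> H}"
  proof -
    have "inv_vertex G v = inv_value [Vertex v]" if "v \<in> H" for v
      using H that by (auto simp: hereditary_def inv_vertex_value)
    then show ?thesis by (metis (no_types, lifting))
  qed
  have 2: "{(inv_mult G (inv_edge G e) (inv_ghost G e), inv_vertex G w) | e w.
        w \<in> W \<and> e \<in> out_arcs (remove_hereditary G H) w}
      = {(inv_value [Edge e, Ghost e], inv_value [Vertex (tail G e)]) | e.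
        e \<in> arcs G \<and> head G e \<notin> H \<and> tail G e \<in> W}"
  proof -
    have "inv_mult G (inv_edge G e) (inv_ghost G e) = inv_value [Edge e, Ghost e]
        \<and> inv_vertex G (tail G e) = inv_value [Vertex (tail G e)]" if "e \<in> arcs G" for e
      using that by (simp add: inv_edge_ghost_value inv_vertex_value)
    moreover have "w \<in> W \<and> e \<in> out_arcs (remove_hereditary G H) w \<longleftrightarrow>
        e \<in> arcs G \<and> head G e \<notin> H \<and> tail G e \<in> W \<and> w = tail G e" for e w
      by auto
    ultimately show ?thesis by (metis (no_types, lifting))
  qed
  have 3: "{(semigroup_power (inv_mult G) (inv_path G c) m, inv_vertex G (tail G (hd c))) | c m.
        c \<in> ?C \<and> f c = enat m}
      = {(inv_value (path_word (concat (replicate m c))), inv_value [Vertex (tail G (hd c))]) | c m.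
        c \<in> ?C \<and> f c = enat m}"
  proof -
    have "semigroup_power (inv_mult G) (inv_path G c) m = inv_value (path_word (concat (replicate m c)))
        \<and> inv_vertex G (tail G (hd c)) = inv_value [Vertex (tail G (hd c))]"
      if "c \<in> ?C" "f c = enat m" for c m
    proof -
      have "c \<noteq> []" and walk: "awalk (tail G (hd c)) c (tail G (hd c))"
        using that(1) by (auto simp: cycles_in_def cycle_iff_distinct_sources awalk_remove_hereditary H)
      \<comment> \<open>Exponent 0 must be excluded: there \<open>semigroup_power\<close> is not the
        value of an empty product.\<close>
      moreover have "m \<ge> 1" using PiE_mem[OF f that(1)] that(2) by (simp add: zero_enat_def)
      ultimately show ?thesis by (auto simp: awalk_def power_inv_path inv_vertex_value)
    qed
    then show ?thesis by (metis (no_types, lifting))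
  qed
  show ?thesis unfolding wp_pairs.simps 1 2 3 ..
qed

lemma congruence_wp_map:
  assumes "t \<in> congruence_triples G"
  shows "congruence_on (Inv G) (inv_mult G) (wp_map G t)"
proof -
  obtain H W f where t: "t = (H, W, f)" by (metis prod_cases3)
  \<comment> \<open>This keeps the power a nonempty word, and only nonempty words denote elements of
    \<open>Inv G\<close>.\<close>
  have "m \<noteq> 0 \<and> c \<noteq> []" if "c \<in> cycles_in (remove_hereditary G H) W" "f c = enat m" for c m
  proof -
    have "0 < f c" using assms that(1) by (auto simp: t congruence_triples_def congruence_pair_def)
    with that show ?thesis
      by (auto simp: zero_enat_def cycles_in_def cycle_iff_distinct_sources)
  qed
  then have "wp_pairs G t \<subseteq> Inv G \<times> Inv G"
    using assms unfolding t
    by (subst wp_pairs_value) (auto intro!: inv_value_in_Inv inv_zero_in_Inv)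
  then show ?thesis
    unfolding wp_map_def by (intro congruence_on_generated inv_mult_closed)
qed

end

section \<open>Every congruence is generated by the pairs of its triple\<close>

lemma (in inv_congruence) wp_map_T_map: "wp_map G (T_map G \<rho>) = \<rho>"
proof -
  let ?H = "T_vertices G \<rho>" and ?W = "T_index_one G \<rho>" and ?f = "T_exponent G \<rho>"
  let ?R = "remove_hereditary G ?H" and ?\<sigma> = "wp_map G (T_map G \<rho>)"
  interpret R: wf_digraph ?R by (rule wf_remove_hereditary[OF T_hereditary])
  interpret S: inv_congruence G ?\<sigma>
    by unfold_locales (rule congruence_wp_map[OF T_map_in_triples])
  note pairs = wp_pairs_value[OF T_map_in_triples[unfolded T_map_def], folded T_map_def]
  \<comment> \<open>\<open>T_index_one\<close> provides some edge at the vertex, whereas the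
    generating pairs involve every remaining edge there; uniqueness identifies them.\<close>
  have index_edge: "quotient [Edge e, Ghost e] = quotient [Vertex (tail G e)]"
    if "e \<in> arcs G" "head G e \<notin> ?H" "tail G e \<in> ?W" for e
  proof -
    from that(3) obtain f where "f \<in> arcs G" "tail G f = tail G e"
      "quotient [Edge f, Ghost f] = quotient [Vertex (tail G e)]" by (auto simp: T_index_one_iff)
    moreover from this have "e = f"
      using that index_edge_unique[of f e] vertex_nonzero_iff[of "head G e"] by auto
    ultimately show ?thesis by simp
  qed
  have "wp_pairs G (T_map G \<rho>) \<subseteq> \<rho>"
  proof -
    have "(inv_value [Vertex v], inv_zero G) \<in> \<rho>" if "v \<in> ?H" for v
      using that by (auto simp: T_vertices_eq quotient_zero_iff)
    moreover have "(inv_value [Edge e, Ghost e], inv_value [Vertex (tail G e)]) \<in> \<rho>"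
      if "e \<in> arcs G" "head G e \<notin> ?H" "tail G e \<in> ?W" for e
      using index_edge[OF that] by (simp add: quotient_eq_iff)
    moreover have "(inv_value (path_word (concat (replicate m c))), inv_value [Vertex (tail G (hd c))]) \<in> \<rho>"
      if c: "c \<in> cycles_in ?R ?W" and m: "?f c = enat m" for c m
    proof -
      from c m have "\<exists>k. loop_power c k" "m = (LEAST m. loop_power c m)"
        by (auto simp: T_exponent_eq split: if_splits)
      then have "loop_power c m" by (auto intro: LeastI)
      then show ?thesis
        using cycles_in_remove_hereditaryD(1)[OF T_hereditary c]
        by (simp add: loop_power_iff)
    qed
    ultimately show ?thesis unfolding pairs by blast
  qed
  then have sub: "?\<sigma> \<subseteq> \<rho>"
    unfolding wp_map_def by (rule generated_congruence_least[OF congruence])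
  have gen: "wp_pairs G (T_map G \<rho>) \<subseteq> ?\<sigma>"
    unfolding wp_map_def by (rule generated_congruence_superset)
  interpret refine: quotient_refinement G quotient zero_class S.quotient S.zero_class
  proof unfold_locales
    show "quotient s = quotient t" if "S.quotient s = S.quotient t" for s t
      using that sub S.quotient_Cons_neq_Nil[of s] S.quotient_Cons_neq_Nil[of t]
      by (cases "s = []"; cases "t = []") (auto simp: quotient_eq_iff S.quotient_eq_iff)
    show "quotient s = zero_class" if "S.quotient s = S.zero_class" for s
    proof -
      have "s \<noteq> []" using that S.class_nonempty[OF inv_zero_in_Inv] by (auto simp: S.quotient_def)
      with that sub show ?thesis by (auto simp: quotient_zero_iff S.quotient_zero_iff)
    qed
    show "S.quotient [Vertex v] = S.zero_class" if "quotient [Vertex v] = zero_class" for v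
    proof (cases "v \<in> verts G")
      case True
      with that have "v \<in> ?H" by (simp add: T_vertices_eq)
      then have "(inv_value [Vertex v], inv_zero G) \<in> ?\<sigma>" using gen unfolding pairs by blast
      then show ?thesis by (simp add: S.quotient_zero_iff)
    next
      case False
      then show ?thesis using S.foreign[of "Vertex v"] by (auto simp: generators_def)
    qed
    show "S.quotient [Edge e, Ghost e] = S.quotient [Vertex (tail G e)]"
      if e: "e \<in> arcs G" and nz: "quotient [Vertex (tail G e)] \<noteq> zero_class"
        and index: "quotient [Edge e, Ghost e] = quotient [Vertex (tail G e)]" for e
    proof -
      have "tail G e \<in> ?W" using e nz index by (auto simp: T_index_one_iff)
      moreover have "head G e \<notin> ?H" using head_nonzero[OF e index nz] vertex_nonzero_iff by blast
      ultimately have "(inv_value [Edge e, Ghost e], inv_value [Vertex (tail G e)]) \<in> ?\<sigma>"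
        using gen e unfolding pairs by blast
      then show ?thesis by (simp add: S.quotient_eq_iff)
    qed
    show "S.quotient (path_word p) = S.quotient [Vertex u]"
      if walk: "awalk u p u" "p \<noteq> []" and nz: "quotient [Vertex u] \<noteq> zero_class"
        and loop: "quotient (path_word p) = quotient [Vertex u]" for u p
    proof -
      \<comment> \<open>By \<open>loop_edge\<close> the loop relation itself forces all its sources
        into \<open>?W\<close>; only then is the closed walk known to be a power of a cycle.\<close>
      have W: "tail G ` set p \<subseteq> ?W"
      proof
        fix v
        assume "v \<in> tail G ` set p"
        then obtain e where e: "e \<in> set p" "v = tail G e" by blast
        moreover have "e \<in> arcs G" using e walk by (auto simp: awalk_def)
        ultimately show "v \<in> ?W" using loop_edge[OF walk(1) loop nz] by (auto simp: T_index_one_iff)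
      qed
      have walk_R: "R.awalk u p u"
        using walk nz vertex_nonzero_iff by (simp add: awalk_remove_hereditary[OF T_hereditary])
      have "out_degree ?R v = 1" if "v \<in> ?W" for v
        using T_map_in_triples that
        by (auto simp: T_map_def congruence_triples_def congruence_pair_def)
      then obtain c k where c: "c \<in> cycles_in ?R ?W" and k: "k \<ge> 1"
        and hd: "tail G (hd c) = u" and p: "p = concat (replicate k c)"
        using R.closed_walk_power[OF walk_R walk(2), of ?W] W by auto
      note walk_c = cycles_in_remove_hereditaryD(2,1)[OF T_hereditary c]
      define m where "m = (LEAST m. loop_power c m)"
      have "loop_power c k" using k hd p loop by (simp add: loop_power_def)
      with c have f: "?f c = enat m" and "m dvd k"
        using loop_power_Least_dvd[OF walk_c] by (auto simp: T_exponent_eq m_def)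
      then obtain d where d: "k = d * m" by (metis dvd_def mult.commute)
      have "m \<ge> 1" using k d by (cases m) auto
      have "(inv_value (path_word (concat (replicate m c))), inv_value [Vertex u]) \<in> ?\<sigma>"
        using gen c f hd unfolding pairs by blast
      then have "S.quotient (path_word (concat (replicate m c))) = S.quotient [Vertex u]"
        using S.quotient_power_eq_iff[OF walk_c(2) \<open>m \<ge> 1\<close>] by simp
      \<comment> \<open>Since p is the d-th power of c^m, the single generating pair for c removes
        all of it.\<close>
      from S.power_loop[OF this, of d "[]"] have "S.quotient (Vertex u # path_word p) = S.quotient [Vertex u]"
        by (simp add: p d concat_replicate_mult)
      then show ?thesis using S.Vertex_path[OF walk, of "[]"] by simp
    qed
  qed
  have "(a, b) \<in> ?\<sigma>" if ab: "(a, b) \<in> \<rho>" for a b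
  proof -
    have sym: "(y, x) \<in> \<tau>" if "congruence_on (Inv G) (inv_mult G) \<tau>" "(x, y) \<in> \<tau>" for x y \<tau>
      using that by (auto simp: congruence_on_def equiv_def dest: symD)
    have "a \<in> Inv G" "b \<in> Inv G"
      using congruence_on_equiv[OF congruence] ab by (auto simp: equiv_def)
    then show ?thesis
    proof (elim Inv_cases)
      assume "a = inv_zero G" "b = inv_zero G"
      then show ?thesis
        using congruence_on_equiv[OF S.congruence] inv_zero_in_Inv by (auto simp: equiv_def refl_on_def)
    next
      fix w
      assume w: "w \<noteq> []" "a = inv_zero G" "b = inv_value w"
      then have "quotient w = zero_class" using sym[OF congruence ab] by (simp add: quotient_zero_iff)
      then have "S.quotient w = S.zero_class" using refine.word_zero w by blast
      then show ?thesis using w sym[OF S.congruence] by (simp add: S.quotient_zero_iff)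
    next
      fix w
      assume w: "w \<noteq> []" "a = inv_value w" "b = inv_zero G"
      then have "quotient w = zero_class" using ab by (simp add: quotient_zero_iff)
      then have "S.quotient w = S.zero_class" using refine.word_zero w by blast
      then show ?thesis using w by (simp add: S.quotient_zero_iff)
    next
      fix s t
      assume st: "s \<noteq> []" "a = inv_value s" "t \<noteq> []" "b = inv_value t"
      then have "quotient s = quotient t" using ab by (simp add: quotient_eq_iff)
      then have "S.quotient s = S.quotient t" using refine.word_eq st by blast
      then show ?thesis using st by (simp add: S.quotient_eq_iff)
    qed
  qed
  with sub show ?thesis by auto
qed

section \<open>Congruences induced on a quotient\<close>

text \<open>The congruence K/\<theta> of the third isomorphism theorem. \<open>Inv G\<close> is
  itself a quotient, so a congruence built on words has to be pushed down to it.\<close>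

definition factor_rel :: "('s \<times> 's) set \<Rightarrow> ('s \<times> 's) set \<Rightarrow> ('s set \<times> 's set) set" where
  "factor_rel \<theta> K = {(\<theta> `` {a}, \<theta> `` {b}) | a b. (a, b) \<in> K}"

lemma factor_rel_iff:
  assumes \<theta>: "equiv S \<theta>" and K: "equiv S K" and sub: "\<theta> \<subseteq> K" and ab: "a \<in> S" "b \<in> S"
  shows "(\<theta> `` {a}, \<theta> `` {b}) \<in> factor_rel \<theta> K \<longleftrightarrow> (a, b) \<in> K"
proof
  assume "(\<theta> `` {a}, \<theta> `` {b}) \<in> factor_rel \<theta> K"
  then obtain c d where cd: "(c, d) \<in> K" "\<theta> `` {a} = \<theta> `` {c}" "\<theta> `` {b} = \<theta> `` {d}"
    by (auto simp: factor_rel_def)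
  have "c \<in> S" "d \<in> S" using cd(1) K by (auto simp: equiv_def)
  then have "(a, c) \<in> K" "(d, b) \<in> K"
    using eq_equiv_class_iff[OF \<theta>, of a c] eq_equiv_class_iff[OF \<theta>, of d b] cd ab sub by auto
  with cd(1) K show "(a, b) \<in> K" unfolding equiv_def by (meson transD)
qed (auto simp: factor_rel_def)

lemma congruence_factor_rel:
  assumes \<theta>: "congruence_on S mul \<theta>" and K: "congruence_on S mul K" and sub: "\<theta> \<subseteq> K"
    and closed: "\<And>a b. a \<in> S \<Longrightarrow> b \<in> S \<Longrightarrow> mul a b \<in> S"
  shows "congruence_on (S // \<theta>) (quotient_mult mul \<theta>) (factor_rel \<theta> K)"
proof -
  note eq\<theta> = congruence_on_equiv[OF \<theta>] and eqK = congruence_on_equiv[OF K]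
  note iff = factor_rel_iff[OF eq\<theta> eqK sub]
  have in_S: "a \<in> S" "b \<in> S" if "(a, b) \<in> K" for a b using that eqK by (auto simp: equiv_def)
  have "equiv (S // \<theta>) (factor_rel \<theta> K)"
  proof (rule equivI)
    show "factor_rel \<theta> K \<subseteq> S // \<theta> \<times> S // \<theta>"
      using in_S by (auto simp: factor_rel_def intro: quotientI)
    show "refl_on (S // \<theta>) (factor_rel \<theta> K)"
      using eqK by (auto simp: refl_on_def iff equiv_def elim!: quotientE)
    show "sym (factor_rel \<theta> K)"
      using eqK by (fastforce simp: sym_def factor_rel_def equiv_def)
    show "trans (factor_rel \<theta> K)"
    proof (rule transI)
      fix A B C
      assume AB: "(A, B) \<in> factor_rel \<theta> K" and BC: "(B, C) \<in> factor_rel \<theta> K"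
      from AB obtain a b where ab: "(a, b) \<in> K" "A = \<theta> `` {a}" "B = \<theta> `` {b}"
        by (auto simp: factor_rel_def)
      from BC obtain b' c where bc: "(b', c) \<in> K" "C = \<theta> `` {c}" by (auto simp: factor_rel_def)
      note abc = in_S[OF ab(1)] in_S(2)[OF bc(1)] ab(2,3) bc(2)
      \<comment> \<open>The middle class came with two representatives; \<open>iff\<close> allows
        \<open>b\<close> to be used in place of \<open>b'\<close>.\<close>
      with BC ab(1) have "(a, b) \<in> K" "(b, c) \<in> K" by (simp_all add: iff)
      then have "(a, c) \<in> K" using eqK unfolding equiv_def by (meson transD)
      with abc show "(A, C) \<in> factor_rel \<theta> K" by (simp add: iff)
    qed
  qed
  moreover have "(quotient_mult mul \<theta> C A, quotient_mult mul \<theta> C B) \<in> factor_rel \<theta> K \<and>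
      (quotient_mult mul \<theta> A C, quotient_mult mul \<theta> B C) \<in> factor_rel \<theta> K"
    if AB: "(A, B) \<in> factor_rel \<theta> K" and C: "C \<in> S // \<theta>" for A B C
  proof -
    from AB obtain a b where ab: "(a, b) \<in> K" "A = \<theta> `` {a}" "B = \<theta> `` {b}"
      by (auto simp: factor_rel_def)
    from C obtain c where c: "c \<in> S" "C = \<theta> `` {c}" by (auto elim: quotientE)
    have "(mul c a, mul c b) \<in> K" "(mul a c, mul b c) \<in> K"
      using K ab(1) c(1) by (auto intro: congruence_on_left congruence_on_right)
    then show ?thesis
      using ab(2,3) c in_S[OF ab(1)] by (simp add: quotient_mult_class[OF \<theta>] iff closed)
  qed
  ultimately show ?thesis unfolding congruence_on_def by auto
qed

section \<open>An action on infinite walks\<close>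

text \<open>
  The graph with vertices outside \<open>H\<close> is enlarged by a loop \<open>Inl v\<close> at every vertex \<open>v\<close> outside \<open>W\<close>.
  Then every vertex starts an infinite walk, walks from \<open>W\<close> have a unique first step, and at a vertex
  outside \<open>W\<close> no single edge starts all the walks. The integer modulo \<open>M\<close> in a state counts edges and
  detects the orders of the cycles.
\<close>

locale triple_model = wf_digraph G for G :: "('v, 'e) pre_digraph" +
  fixes H W :: "'v set" and f :: "'e list \<Rightarrow> enat"
  assumes triple: "(H, W, f) \<in> congruence_triples G"
begin

abbreviation R :: "('v, 'e) pre_digraph" where
  "R \<equiv> remove_hereditary G H"

lemma hereditary: "hereditary G H"
  and W_subset: "W \<subseteq> verts G - H"
  and W_index: "v \<in> W \<Longrightarrow> out_degree R v = 1"
  and exponent_PiE: "f \<in> cycles_in R W \<rightarrow>\<^sub>E {0<..}"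
  and exponent_rotate: "c \<in> cycles_in R W \<Longrightarrow> f (rotate n c) = f c"
  using triple by (auto simp: congruence_triples_def congruence_pair_def)

sublocale R: wf_digraph R
  by (rule wf_remove_hereditary[OF hereditary])

lemma cycleD:
  assumes "c \<in> cycles_in R W"
  shows "c \<noteq> []" "R.awalk (tail G (hd c)) c (tail G (hd c))" "tail G ` set c \<subseteq> W"
    "distinct (map (tail G) c)" "tail G (hd c) \<in> W"
proof -
  show c: "c \<noteq> []" "tail G ` set c \<subseteq> W" and "R.awalk (tail G (hd c)) c (tail G (hd c))"
    "distinct (map (tail G) c)"
    using assms by (auto simp: cycles_in_def cycle_iff_distinct_sources)
  show "tail G (hd c) \<in> W" using c by auto
qed

lemma W_edge:
  assumes "v \<in> W"
  obtains e where "e \<in> arcs R" "tail G e = v"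
proof -
  obtain e where "out_arcs R v = {e}"
    using W_index[OF assms] unfolding out_degree_def by (rule card_1_singletonE)
  then have "e \<in> out_arcs R v" by simp
  then show thesis using that[of e] by simp
qed

lemma W_edge_unique: "e \<in> arcs R \<Longrightarrow> g \<in> arcs R \<Longrightarrow> tail G e \<in> W \<Longrightarrow> tail G g = tail G e \<Longrightarrow> g = e"
  using R.out_edge_unique[of e g] W_index by simp

fun src :: "'v + 'e \<Rightarrow> 'v" where
  "src (Inl v) = v"
| "src (Inr e) = tail G e"

fun trg :: "'v + 'e \<Rightarrow> 'v" where
  "trg (Inl v) = v"
| "trg (Inr e) = head G e"

definition letters :: "('v + 'e) set" where
  "letters = Inl ` (verts G - H - W) \<union> Inr ` arcs R"

definition walks :: "('v + 'e) stream set" where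
  "walks = {x. \<forall>i. x !! i \<in> letters \<and> trg (x !! i) = src (x !! Suc i)}"

lemma src_letter: "l \<in> letters \<Longrightarrow> src l \<in> verts G - H"
  using hereditary by (auto simp: letters_def hereditary_def)

lemma SCons_walk_iff: "l ## x \<in> walks \<longleftrightarrow> l \<in> letters \<and> trg l = src (shd x) \<and> x \<in> walks"
proof -
  have all: "(\<forall>i. Q i) \<longleftrightarrow> Q 0 \<and> (\<forall>i. Q (Suc i))" for Q :: "nat \<Rightarrow> bool"
    by (metis not0_implies_Suc)
  show ?thesis
    unfolding walks_def mem_Collect_eq
    by (subst all) auto
qed

lemma walkD:
  assumes "x \<in> walks"
  shows "shd x \<in> letters" "src (shd (stl x)) = trg (shd x)" "stl x \<in> walks"
  using assms SCons_walk_iff[of "shd x" "stl x"] by simp_all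

lemma walk_exists:
  assumes "v \<in> verts G - H"
  obtains x where "x \<in> walks" "src (shd x) = v"
proof -
  \<comment> \<open>In \<open>W\<close> the walk follows the only edge; elsewhere it circles on the
    added loop, so that sinks cause no trouble.\<close>
  define step where "step = (\<lambda>v. if v \<in> W then Inr (SOME e. e \<in> arcs R \<and> tail G e = v) else Inl v)"
  have step: "step w \<in> letters \<and> src (step w) = w \<and> trg (step w) \<in> verts G - H"
    if w: "w \<in> verts G - H" for w
  proof (cases "w \<in> W")
    case True
    then have "\<exists>e. e \<in> arcs R \<and> tail G e = w" using W_edge by metis
    then have "(SOME e. e \<in> arcs R \<and> tail G e = w) \<in> arcs R \<and> tail G (SOME e. e \<in> arcs R \<and> tail G e = w) = w"
      by (rule someI_ex)
    with True show ?thesis by (auto simp: step_def letters_def)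
  qed (use w in \<open>simp add: step_def letters_def\<close>)
  define x where "x = smap step (siterate (trg \<circ> step) v)"
  have verts: "((trg \<circ> step) ^^ i) v \<in> verts G - H" for i
    using assms step by (induction i) auto
  have x: "x !! i = step (((trg \<circ> step) ^^ i) v)" for i
    by (simp add: x_def)
  have "x !! i \<in> letters \<and> trg (x !! i) = src (x !! Suc i)" for i
    unfolding x using step[OF verts[of i]] step[OF verts[of "Suc i"]] by simp
  then have "x \<in> walks" by (simp add: walks_def)
  moreover have "src (shd x) = v"
    using step[OF assms] by (simp add: x_def)
  ultimately show thesis by (rule that)
qed

section \<open>Walks starting in \<open>W\<close> are forced\<close>

lemma walk_from_W_Inr:
  assumes "x \<in> walks" "e \<in> arcs R" "tail G e \<in> W" "src (shd x) = tail G e"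
  shows "shd x = Inr e"
proof -
  have "shd x \<in> letters" using assms(1) by (rule walkD)
  then show ?thesis
    using assms(2-4) W_edge_unique[of e] by (auto simp: letters_def)
qed

lemma walk_prefix_W:
  assumes "R.awalk u p v" "tail G ` set p \<subseteq> W" "x \<in> walks" "src (shd x) = u"
  shows "\<exists>y \<in> walks. x = map Inr p @- y \<and> src (shd y) = v"
  using assms
proof (induction p arbitrary: u x)
  case Nil
  then show ?case by (auto simp: R.awalk_simps)
next
  case (Cons e p)
  then have "shd x = Inr e" by (intro walk_from_W_Inr) (auto simp: R.awalk_simps)
  then have x: "x = Inr e ## stl x" by (metis stream.collapse)
  have "src (shd (stl x)) = head G e"
    using walkD(2)[OF Cons.prems(3)] \<open>shd x = Inr e\<close> by simp
  with Cons.prems have "\<exists>y \<in> walks. stl x = map Inr p @- y \<and> src (shd y) = v"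
    by (intro Cons.IH[of "head G e"] walkD(3)) (auto simp: R.awalk_simps)
  then obtain y where y: "y \<in> walks" "stl x = map Inr p @- y" "src (shd y) = v" by blast
  from y(2) have "x = map Inr (e # p) @- y" by (subst x) simp
  with y show ?case by blast
qed

lemma walk_cycle_unfold:
  assumes c: "c \<in> cycles_in R W" and x: "x \<in> walks" "src (shd x) = tail G (hd c)"
  obtains y where "y \<in> walks" "x = map Inr c @- y" "src (shd y) = tail G (hd c)"
  using walk_prefix_W[OF cycleD(2,3)[OF c] x] by blast

text \<open>Both walks begin with a full copy of \<open>c\<close>, and removing it moves a position
  back by the length of \<open>c\<close>.\<close>

lemma walk_cycle_unique:
  assumes c: "c \<in> cycles_in R W"
    and "x \<in> walks" "src (shd x) = tail G (hd c)" "y \<in> walks" "src (shd y) = tail G (hd c)"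
  shows "x = y"
proof -
  have "x !! n = y !! n" for n
    using assms(2-)
  proof (induction n arbitrary: x y rule: less_induct)
    case (less n)
    obtain x' where x': "x' \<in> walks" "x = map Inr c @- x'" "src (shd x') = tail G (hd c)"
      using walk_cycle_unfold[OF c less.prems(1,2)] .
    obtain y' where y': "y' \<in> walks" "y = map Inr c @- y'" "src (shd y') = tail G (hd c)"
      using walk_cycle_unfold[OF c less.prems(3,4)] .
    show ?case
    proof (cases "n < length c")
      case False
      then have "n - length c < n" using cycleD(1)[OF c] by (cases n) auto
      then have "x' !! (n - length c) = y' !! (n - length c)"
        using x' y' by (intro less.IH)
      with False show ?thesis by (simp add: x'(2) y'(2))
    qed (simp add: x'(2) y'(2))
  qed
  \<comment> \<open>\<open>smap_alt\<close> serves as the pointwise criterion for equality of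
    streams.\<close>
  then have "smap id x = y" by (simp add: smap_alt)
  then show ?thesis by (simp add: stream.map_id)
qed

text \<open>On walks alone every power of \<open>c\<close> thus acts like its source vertex; the
  exponent is visible only in the counter.\<close>

lemma walk_cycle_fixed:
  assumes c: "c \<in> cycles_in R W" and x: "x \<in> walks" "src (shd x) = tail G (hd c)"
  shows "map Inr c @- x = x"
proof -
  obtain y where "y \<in> walks" "x = map Inr c @- y" "src (shd y) = tail G (hd c)"
    using walk_cycle_unfold[OF c x] .
  moreover from this have "x = y" using walk_cycle_unique[OF c x] by blast
  ultimately show ?thesis by simp
qed

text \<open>Rotate \<open>c\<close> so that it starts with the first edge of \<open>d\<close>. Both
  cycles then follow forced edges, so one is a prefix of the other, and a proper prefix would repeat
  the first source. This makes one modulus suit every cycle that meets \<open>c\<close>.\<close>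

lemma cycle_with_common_edge:
  assumes c: "c \<in> cycles_in R W" and d: "d \<in> cycles_in R W" and "hd d \<in> set c"
  shows "f d = f c \<and> length d = length c"
proof -
  from assms(3) obtain as bs where as: "c = as @ hd d # bs" by (auto simp: in_set_conv_decomp)
  define c' where "c' = rotate (length as) c"
  have c': "c' \<in> cycles_in R W" unfolding c'_def by (rule R.cycles_in_rotate[OF c])
  have hd: "hd c' = hd d" by (simp add: c'_def as rotate_append)
  have prefix_eq: "r = []"
    if ab: "a \<in> cycles_in R W" "b \<in> cycles_in R W" "hd a = hd b" and r: "b = a @ r" for a b r
  proof (rule ccontr)
    assume "r \<noteq> []"
    let ?u = "tail G (hd a)"
    have walk_a: "R.awalk ?u a ?u" by (rule cycleD(2)[OF ab(1)])
    have "R.awalk ?u (a @ r) ?u" using cycleD(2)[OF ab(2)] ab(3) r by simp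
    moreover have "R.awlast ?u a = ?u" using walk_a by auto
    ultimately have "R.awalk ?u r ?u" by simp
    then have "tail G (hd r) = ?u" using \<open>r \<noteq> []\<close> by (cases r) (auto simp: R.awalk_simps)
    moreover have "hd a \<in> set a" "hd r \<in> set r" using \<open>r \<noteq> []\<close> cycleD(1)[OF ab(1)] by auto
    ultimately show False using cycleD(4)[OF ab(2)] r by (auto simp: disjoint_iff)
  qed
  have index: "out_degree R (tail R e) = 1" if "e \<in> set c' \<union> set d" for e
    using that cycleD(3)[OF c'] cycleD(3)[OF d] W_index by auto
  have walks: "R.awalk (tail G (hd d)) c' (tail G (hd d))" "R.awalk (tail G (hd d)) d (tail G (hd d))"
    using cycleD(2)[OF c'] cycleD(2)[OF d] hd by simp_all
  have "c' = d"
  proof (cases "length c' \<le> length d")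
    case True
    then obtain r where "d = c' @ r" using R.walk_prefix[OF walks] index by blast
    with prefix_eq[OF c' d hd] show ?thesis by simp
  next
    case False
    then obtain r where "c' = d @ r" using R.walk_prefix[OF walks(2,1)] index by auto
    with prefix_eq[OF d c' hd[symmetric]] show ?thesis by simp
  qed
  then show ?thesis using exponent_rotate[OF c, of "length as"] by (auto simp: c'_def)
qed

end

text \<open>\<open>P\<close> is the set of walks acted upon; \<open>P_stl\<close> keeps it invariant
  under adding and removing steps. \<open>P_exponent\<close> says that c^f(c) leaves the counter
  unchanged, and it is demanded only where a walk of \<open>P\<close> starts at the base of
  c.\<close>

locale triple_action = triple_model G H W f for G :: "('v, 'e) pre_digraph" and H W f +
  fixes P :: "('v + 'e) stream set" and M :: int
  assumes P_walks: "P \<subseteq> walks"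
    and P_stl: "x \<in> walks \<Longrightarrow> stl x \<in> P \<longleftrightarrow> x \<in> P"
    and P_exponent: "c \<in> cycles_in R W \<Longrightarrow> f c = enat m \<Longrightarrow> x \<in> P \<Longrightarrow> src (shd x) = tail G (hd c)
      \<Longrightarrow> M dvd int (m * length c)"
begin

text \<open>Partial maps written on the left, so \<open>act_word\<close> applies the last letter
  first. An edge prepends a step and its ghost removes it; no generator adds or removes an added
  loop.\<close>

fun act :: "('v, 'e) generator \<Rightarrow> ('v + 'e) stream \<times> int \<Rightarrow> (('v + 'e) stream \<times> int) option" where
  "act (Vertex v) (x, k) = (if src (shd x) = v then Some (x, k) else None)"
| "act (Edge e) (x, k) =
     (if e \<in> arcs R \<and> src (shd x) = head G e then Some (Inr e ## x, (k + 1) mod M) else None)"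
| "act (Ghost e) (x, k) = (if shd x = Inr e then Some (stl x, (k - 1) mod M) else None)"

fun act_word :: "('v, 'e) generator list \<Rightarrow> ('v + 'e) stream \<times> int \<Rightarrow> (('v + 'e) stream \<times> int) option" where
  "act_word [] s = Some s"
| "act_word (g # w) s = Option.bind (act_word w s) (act g)"

fun act_word0 :: "('v, 'e) word0 \<Rightarrow> ('v + 'e) stream \<times> int \<Rightarrow> (('v + 'e) stream \<times> int) option" where
  "act_word0 None s = None"
| "act_word0 (Some w) s = act_word w s"

text \<open>Counters are reduced residues. As \<open>k mod 0 = k\<close>, the modulus 0 admits all
  integers.\<close>

definition states :: "(('v + 'e) stream \<times> int) set" where
  "states = {(x, k). x \<in> P \<and> k mod M = k}"

lemma act_word_append: "act_word (u @ w) s = Option.bind (act_word w s) (act_word u)"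
  by (induction u) simp_all

lemma act_word0_mult: "act_word0 (free0_mult a b) s = Option.bind (act_word0 b s) (act_word0 a)"
  by (cases a; cases b) (auto simp: act_word_append bind_eq_Some_conv split: bind_split)

lemma act_states: "s \<in> states \<Longrightarrow> act g s = Some t \<Longrightarrow> t \<in> states"
proof (cases s)
  case (Pair x k)
  assume s: "s \<in> states" and t: "act g s = Some t"
  then have x: "x \<in> P" "x \<in> walks" "k mod M = k" using P_walks by (auto simp: states_def Pair)
  show ?thesis
  proof (cases g)
    case (Vertex v)
    with s t show ?thesis by (auto simp: Pair split: if_splits)
  next
    case (Edge e)
    then have e: "e \<in> arcs R" "src (shd x) = head G e" and t: "t = (Inr e ## x, (k + 1) mod M)"
      using t by (auto simp: Pair split: if_splits)
    have "Inr e ## x \<in> walks" using e x(2) by (simp add: SCons_walk_iff letters_def)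
    from P_stl[OF this] show ?thesis using x by (simp add: t states_def)
  next
    case (Ghost e)
    then show ?thesis
      using t x P_stl[OF x(2)] by (auto simp: Pair states_def split: if_splits)
  qed
qed

lemma act_word_states: "s \<in> states \<Longrightarrow> act_word w s = Some t \<Longrightarrow> t \<in> states"
  by (induction w arbitrary: t) (auto simp: bind_eq_Some_conv intro: act_states)

lemma act_word0_states: "s \<in> states \<Longrightarrow> act_word0 a s = Some t \<Longrightarrow> t \<in> states"
  by (cases a) (auto intro: act_word_states)

definition kernel :: "(('v, 'e) word0 \<times> ('v, 'e) word0) set" where
  "kernel = {(a, b) \<in> free0 G \<times> free0 G. \<forall>s \<in> states. act_word0 a s = act_word0 b s}"

text \<open>In a product with \<open>c\<close> on the right, \<open>c\<close> acts first; hence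
  invariance of \<open>states\<close> is needed, as \<open>a\<close> and \<open>b\<close> agree only
  there.\<close>

lemma congruence_kernel: "congruence_on (free0 G) free0_mult kernel"
proof -
  have "equiv (free0 G) kernel"
    by (rule equivI) (auto simp: kernel_def refl_on_def sym_def trans_def)
  moreover have "(free0_mult c a, free0_mult c b) \<in> kernel \<and> (free0_mult a c, free0_mult b c) \<in> kernel"
    if "(a, b) \<in> kernel" "c \<in> free0 G" for a b c
  proof -
    have "Option.bind (act_word0 c s) (act_word0 a) = Option.bind (act_word0 c s) (act_word0 b)"
      if "s \<in> states" for s
      using act_word0_states[OF that, of c] \<open>(a, b) \<in> kernel\<close>
      by (cases "act_word0 c s") (auto simp: kernel_def)
    with that show ?thesis
      by (auto simp: kernel_def act_word0_mult free0_mult_closed)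
  qed
  ultimately show ?thesis unfolding congruence_on_def by auto
qed

lemma stateD:
  assumes "(x, k) \<in> states"
  shows "shd x \<in> letters" "src (shd (stl x)) = trg (shd x)" "src (shd x) \<in> verts G - H" "k mod M = k"
    "x \<in> walks" "x \<in> P"
  using assms P_walks walkD src_letter by (auto simp: states_def)

lemma inv_relations_kernel: "inv_relations G \<subseteq> kernel"
proof (rule subrelI)
  fix a b
  assume rel: "(a, b) \<in> inv_relations G"
  have "act_word0 a (x, k) = act_word0 b (x, k)" if s: "(x, k) \<in> states" for x k
    using rel
  proof cases
    case (range_ghost e)
    then show ?thesis using stateD(2)[OF s] by auto
  next
    case (ghost_edge e g)
    \<comment> \<open>The counter returns to \<open>k\<close> because it is reduced. Walks avoid
      \<open>H\<close>, so an edge of \<open>G\<close> whose range starts a walk belongs to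
      \<open>R\<close>.\<close>
    have "(k + 1 - 1) mod M = k" using stateD(4)[OF s] by simp
    then have "((k + 1) mod M - 1) mod M = k" by (metis mod_diff_left_eq)
    then show ?thesis
      using ghost_edge stateD(3)[OF s] by auto
  qed auto
  then show "(a, b) \<in> kernel"
    using rel inv_relations_subset by (auto simp: kernel_def)
qed

lemma inv_cong_kernel: "inv_cong G \<subseteq> kernel"
  unfolding inv_cong_def by (intro generated_congruence_least congruence_kernel inv_relations_kernel)

abbreviation model_congruence :: "(('v, 'e) inv_elem \<times> ('v, 'e) inv_elem) set" where
  "model_congruence \<equiv> factor_rel (inv_cong G) kernel"

lemma congruence_model: "congruence_on (Inv G) (inv_mult G) model_congruence"
  unfolding Inv_def inv_mult_def
  by (intro congruence_factor_rel congruence_inv_cong congruence_kernel inv_cong_kernel free0_mult_closed)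

lemma model_word_iff:
  assumes "s \<noteq> []" "set s \<subseteq> generators G" "t \<noteq> []" "set t \<subseteq> generators G"
  shows "(inv_value s, inv_value t) \<in> model_congruence \<longleftrightarrow> (\<forall>a \<in> states. act_word s a = act_word t a)"
  using assms factor_rel_iff[OF equiv_inv_cong congruence_on_equiv[OF congruence_kernel] inv_cong_kernel,
      of "Some s" "Some t"]
  by (simp add: inv_value_def inv_word_def Some_in_free0 kernel_def)

lemma model_zero_iff:
  assumes "s \<noteq> []" "set s \<subseteq> generators G"
  shows "(inv_value s, inv_zero G) \<in> model_congruence \<longleftrightarrow> (\<forall>a \<in> states. act_word s a = None)"
  using assms factor_rel_iff[OF equiv_inv_cong congruence_on_equiv[OF congruence_kernel] inv_cong_kernel,
      of "Some s" None]
  by (simp add: inv_value_def inv_word_def inv_zero_def Some_in_free0 None_in_free0 kernel_def)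

lemma act_path:
  assumes "R.awalk u p v" "x \<in> walks" "src (shd x) = v" "k mod M = k"
  shows "act_word (path_word p) (x, k) = Some (map Inr p @- x, (k + int (length p)) mod M)
    \<and> src (shd (map Inr p @- x)) = u"
  using assms
proof (induction p arbitrary: u)
  case (Cons e p)
  then have "act_word (path_word p) (x, k) = Some (map Inr p @- x, (k + int (length p)) mod M)
    \<and> src (shd (map Inr p @- x)) = head G e"
    by (intro Cons.IH) (auto simp: R.awalk_simps)
  then show ?case
    using Cons.prems(1) by (auto simp: R.awalk_simps mod_add_left_eq mod_add_right_eq add_ac)
qed (auto simp: R.awalk_simps)

lemma act_path_None:
  assumes "R.awalk u p v" "p \<noteq> []" "src (shd x) \<noteq> v"
  shows "act_word (path_word p) (x, k) = None"
  using assms by (cases p rule: rev_cases) (auto simp: act_word_append R.awalk_append_ex_iff R.awalk_simps)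

lemma act_cycle_power:
  assumes c: "c \<in> cycles_in R W" and x: "x \<in> walks" "src (shd x) = tail G (hd c)" and k: "k mod M = k"
  shows "act_word (path_word (concat (replicate m c))) (x, k) = Some (x, (k + int (m * length c)) mod M)"
proof -
  have fixed: "map Inr (concat (replicate m c)) @- x = x"
    by (induction m) (simp_all add: walk_cycle_fixed[OF c x])
  have "length (concat (replicate m c)) = m * length c"
    by (induction m) simp_all
  then show ?thesis
    using act_path[OF R.awalk_power[OF cycleD(2)[OF c]] x k, of m] fixed by simp
qed

lemma set_cycle_power_generators:
  assumes "c \<in> cycles_in R W"
  shows "set (path_word (concat (replicate m c))) \<subseteq> generators G"
  using cycleD(2)[OF assms] by (auto simp: R.awalk_def generators_def split: if_splits)

text \<open>Bounds the generated congruence from above. No walk starts in \<open>H\<close>, a walk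
  from \<open>W\<close> begins with the only available edge, and \<open>P_exponent\<close> returns
  the counter to its value; so the action respects all generating pairs.\<close>

lemma wp_map_model: "wp_map G (H, W, f) \<subseteq> model_congruence"
proof -
  have "(inv_value [Vertex v], inv_zero G) \<in> model_congruence" if "v \<in> H" for v
  proof -
    have "v \<in> verts G" using that hereditary by (auto simp: hereditary_def)
    then show ?thesis
      using that stateD(3) by (subst model_zero_iff) (auto simp: generators_def)
  qed
  moreover have "(inv_value [Edge e, Ghost e], inv_value [Vertex (tail G e)]) \<in> model_congruence"
    if e: "e \<in> arcs G" "head G e \<notin> H" "tail G e \<in> W" for e
  proof -
    have "act_word [Edge e, Ghost e] (x, k) = act_word [Vertex (tail G e)] (x, k)"
      if s: "(x, k) \<in> states" for x k
    proof (cases "src (shd x) = tail G e")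
      case True
      then have shd: "shd x = Inr e"
        using e stateD(5)[OF s] by (intro walk_from_W_Inr) auto
      then have "Inr e ## stl x = x" by (metis stream.collapse)
      moreover have "((k - 1) mod M + 1) mod M = k" using stateD(4)[OF s] by (simp add: mod_add_left_eq)
      ultimately show ?thesis using shd e stateD(2)[OF s] by simp
    next
      case False
      then have "shd x \<noteq> Inr e" by auto
      with False show ?thesis by simp
    qed
    then show ?thesis using e by (subst model_word_iff) (auto simp: generators_def)
  qed
  moreover have "(inv_value (path_word (concat (replicate m c))), inv_value [Vertex (tail G (hd c))])
      \<in> model_congruence" if c: "c \<in> cycles_in R W" and m: "f c = enat m" for c m
  proof -
    have "m \<noteq> 0" using PiE_mem[OF exponent_PiE c] m by (simp add: zero_enat_def)
    have act_eq: "act_word (path_word (concat (replicate m c))) (x, k) = act_word [Vertex (tail G (hd c))] (x, k)"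
      if s: "(x, k) \<in> states" for x k
    proof (cases "src (shd x) = tail G (hd c)")
      case True
      then have "M dvd int (m * length c)" using P_exponent[OF c m] stateD(6)[OF s] by blast
      then have "(k + int (m * length c)) mod M = k" using stateD(4)[OF s] by (auto elim!: dvdE)
      then show ?thesis using act_cycle_power[OF c stateD(5)[OF s] True stateD(4)[OF s], of m] True by simp
    next
      case False
      then show ?thesis
        using act_path_None[OF R.awalk_power[OF cycleD(2)[OF c]], of m x k] \<open>m \<noteq> 0\<close> cycleD(1)[OF c] by simp
    qed
    show ?thesis
    proof (subst model_word_iff)
      show "path_word (concat (replicate m c)) \<noteq> []" using \<open>m \<noteq> 0\<close> cycleD(1)[OF c] by auto
      show "set (path_word (concat (replicate m c))) \<subseteq> generators G"
        by (rule set_cycle_power_generators[OF c])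
      show "set [Vertex (tail G (hd c))] \<subseteq> generators G"
        using cycleD(5)[OF c] W_subset by (auto simp: generators_def)
      show "\<forall>a\<in>states. act_word (path_word (concat (replicate m c))) a = act_word [Vertex (tail G (hd c))] a"
        using act_eq by auto
    qed simp
  qed
  ultimately have "wp_pairs G (H, W, f) \<subseteq> model_congruence"
    unfolding wp_pairs_value[OF triple] by blast
  then show ?thesis
    unfolding wp_map_def by (rule generated_congruence_least[OF congruence_model])
qed

end

section \<open>Recovering the triple from the generated congruence\<close>

context triple_model
begin

text \<open>Modulus 1 switches the counter off and makes \<open>P_exponent\<close> trivial; this
  action already detects \<open>H\<close> and \<open>W\<close>.\<close>

lemma full_action: "triple_action G H W f walks 1"
  by unfold_locales (auto simp: walkD intro: SCons_walk_iff[THEN iffD1])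

lemma vertex_not_zero:
  assumes "v \<in> verts G - H"
  shows "(inv_value [Vertex v], inv_zero G) \<notin> wp_map G (H, W, f)"
proof
  interpret A: triple_action G H W f walks 1 by (rule full_action)
  assume "(inv_value [Vertex v], inv_zero G) \<in> wp_map G (H, W, f)"
  then have None: "\<forall>a \<in> A.states. A.act_word [Vertex v] a = None"
    using A.wp_map_model assms by (subst A.model_zero_iff[symmetric]) (auto simp: generators_def)
  obtain x where "x \<in> walks" "src (shd x) = v" using walk_exists[OF assms] .
  moreover from this have "(x, 0) \<in> A.states" by (simp add: A.states_def)
  ultimately show False using None by fastforce
qed

lemma index_one_in_W:
  assumes "v \<in> verts G - H" "e \<in> arcs G"
    and rel: "(inv_value [Edge e, Ghost e], inv_value [Vertex v]) \<in> wp_map G (H, W, f)"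
  shows "v \<in> W"
proof (rule ccontr)
  interpret A: triple_action G H W f walks 1 by (rule full_action)
  assume "v \<notin> W"
  \<comment> \<open>The walk that stays on the added loop is fixed by v but not in the domain of
    e*.\<close>
  then have "sconst (Inl v) \<in> walks" using assms(1) by (simp add: walks_def letters_def)
  then have "(sconst (Inl v), 0) \<in> A.states" by (simp add: A.states_def)
  moreover have "\<forall>a \<in> A.states. A.act_word [Edge e, Ghost e] a = A.act_word [Vertex v] a"
    using A.wp_map_model assms by (subst A.model_word_iff[symmetric]) (auto simp: generators_def)
  ultimately show False by fastforce
qed

lemma cycle_exponent_dvd:
  assumes c: "c \<in> cycles_in R W" and m: "m \<ge> 1"
    and rel: "(inv_value (path_word (concat (replicate m c))), inv_value [Vertex (tail G (hd c))])
      \<in> wp_map G (H, W, f)"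
  shows "\<exists>n. f c = enat n \<and> n dvd m"
proof -
  \<comment> \<open>Only walks that end up on \<open>c\<close>, so that no cycle with an unrelated
    exponent constrains the modulus.\<close>
  define P where "P = {x \<in> walks. \<exists>N. \<forall>i\<ge>N. x !! i \<in> Inr ` set c}"
  \<comment> \<open>The length enters because the counter counts edges rather than turns.\<close>
  define M where "M = (case f c of enat n \<Rightarrow> int (n * length c) | \<infinity> \<Rightarrow> 0)"
  interpret A: triple_action G H W f P M
  proof unfold_locales
    show "P \<subseteq> walks" by (auto simp: P_def)
  next
    fix x
    assume x: "x \<in> walks"
    have "(\<exists>N. \<forall>i\<ge>N. stl x !! i \<in> Inr ` set c) \<longleftrightarrow> (\<exists>N. \<forall>i\<ge>N. x !! i \<in> Inr ` set c)"
    proof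
      assume "\<exists>N. \<forall>i\<ge>N. stl x !! i \<in> Inr ` set c"
      then obtain N where N: "\<forall>i\<ge>N. x !! Suc i \<in> Inr ` set c" by auto
      have "x !! i \<in> Inr ` set c" if "i \<ge> Suc N" for i
        using N that by (cases i) auto
      then show "\<exists>N. \<forall>i\<ge>N. x !! i \<in> Inr ` set c" by blast
    next
      assume "\<exists>N. \<forall>i\<ge>N. x !! i \<in> Inr ` set c"
      then obtain N where "\<forall>i\<ge>N. x !! i \<in> Inr ` set c" by blast
      then have "\<forall>i\<ge>N. stl x !! i \<in> Inr ` set c" by (metis le_SucI snth.simps(2))
      then show "\<exists>N. \<forall>i\<ge>N. stl x !! i \<in> Inr ` set c" by blast
    qed
    with x walkD(3)[OF x] show "stl x \<in> P \<longleftrightarrow> x \<in> P" by (simp add: P_def)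
  next
    fix d k x
    assume d: "d \<in> cycles_in R W" and k: "f d = enat k" and x: "x \<in> P" "src (shd x) = tail G (hd d)"
    from x obtain N where N: "\<forall>i\<ge>N. x !! i \<in> Inr ` set c" and "x \<in> walks" by (auto simp: P_def)
    \<comment> \<open>The walk repeats \<open>d\<close> forever, so the first edge of
      \<open>d\<close> recurs arbitrarily late and must lie on \<open>c\<close>; position
      \<open>N * length d\<close> is late enough.\<close>
    have "x !! (j * length d) = Inr (hd d)" for j
    proof (induction j)
      case 0
      show ?case using walk_cycle_fixed[OF d \<open>x \<in> walks\<close> x(2)] cycleD(1)[OF d]
        by (metis hd_map map_is_Nil_conv mult_0 shift_simps(1) snth.simps(1))
    next
      case (Suc j)
      have "x !! (Suc j * length d) = (map Inr d @- x) !! (length d + j * length d)"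
        using walk_cycle_fixed[OF d \<open>x \<in> walks\<close> x(2)] by simp
      also have "\<dots> = x !! (j * length d)" by (subst shift_snth_ge) simp_all
      finally show ?case using Suc by simp
    qed
    moreover have "x !! (N * length d) \<in> Inr ` set c"
      using N cycleD(1)[OF d] by (cases d) auto
    ultimately have "hd d \<in> set c" by auto
    from cycle_with_common_edge[OF c d this] k have "f c = enat k" "length d = length c" by simp_all
    then show "M dvd int (k * length d)" by (simp add: M_def)
  qed
  let ?u = "tail G (hd c)"
  have u: "?u \<in> verts G - H" using cycleD(5)[OF c] W_subset by auto
  obtain x where x: "x \<in> walks" "src (shd x) = ?u" using walk_exists[OF u] .
  have "x !! i \<in> Inr ` set c" for i
  proof (induction i rule: less_induct)
    case (less i)
    have "x !! i = (map Inr c @- x) !! i" using walk_cycle_fixed[OF c x] by simp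
    moreover have "i - length c < i" if "\<not> i < length c"
      using that cycleD(1)[OF c] by (cases i) auto
    ultimately show ?case
      using less[of "i - length c"] by (cases "i < length c") auto
  qed
  then have "x \<in> P" using x(1) by (simp add: P_def)
  then have "(x, 0) \<in> A.states" by (simp add: A.states_def)
  moreover have "\<forall>a \<in> A.states. A.act_word (path_word (concat (replicate m c))) a = A.act_word [Vertex ?u] a"
  proof (subst A.model_word_iff[symmetric])
    show "path_word (concat (replicate m c)) \<noteq> []" using m cycleD(1)[OF c] by auto
    show "set (path_word (concat (replicate m c))) \<subseteq> generators G"
      by (rule A.set_cycle_power_generators[OF c])
    show "set [Vertex ?u] \<subseteq> generators G" using u by (auto simp: generators_def)
    show "(inv_value (path_word (concat (replicate m c))), inv_value [Vertex ?u]) \<in> A.model_congruence"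
      using rel A.wp_map_model by blast
  qed simp
  \<comment> \<open>Both words fix the walk, so only the counters started at 0 are compared.\<close>
  ultimately have "int (m * length c) mod M = 0"
    using A.act_cycle_power[OF c x, of 0 m] x by auto
  then have dvd: "M dvd int (m * length c)" by (simp add: dvd_eq_mod_eq_0)
  show ?thesis
  proof (cases "f c")
    case (enat n)
    then have "n * length c dvd m * length c" using dvd unfolding M_def by (simp flip: of_nat_mult)
    then show ?thesis using enat cycleD(1)[OF c] by simp
  next
    case infinity
    \<comment> \<open>Here M = 0 would have to divide a positive number, so no exponent
      exists.\<close>
    then show ?thesis using dvd m cycleD(1)[OF c] by (simp add: M_def)
  qed
qed

lemma T_map_wp_map: "T_map G (wp_map G (H, W, f)) = (H, W, f)"
proof -
  let ?\<sigma> = "wp_map G (H, W, f)"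
  interpret S: inv_congruence G ?\<sigma>
    by unfold_locales (rule congruence_wp_map[OF triple])
  note pairs = wp_pairs_value[OF triple]
  have gen: "wp_pairs G (H, W, f) \<subseteq> ?\<sigma>"
    unfolding wp_map_def by (rule generated_congruence_superset)
  have H_verts: "H \<subseteq> verts G" using hereditary by (simp add: hereditary_def)
  have "(inv_value [Vertex v], inv_zero G) \<in> ?\<sigma> \<longleftrightarrow> v \<in> H" if "v \<in> verts G" for v
  proof
    assume "v \<in> H"
    then show "(inv_value [Vertex v], inv_zero G) \<in> ?\<sigma>" using gen unfolding pairs by blast
  qed (use vertex_not_zero that in blast)
  then have H: "T_vertices G ?\<sigma> = H"
    using H_verts by (auto simp: S.T_vertices_eq S.quotient_zero_iff)
  have W: "T_index_one G ?\<sigma> = W"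
  proof (intro equalityI subsetI)
    fix v
    assume "v \<in> T_index_one G ?\<sigma>"
    then show "v \<in> W"
      using index_one_in_W H by (auto simp: S.T_index_one_iff S.quotient_eq_iff S.vertex_nonzero_iff)
  next
    fix v
    assume v: "v \<in> W"
    then obtain e where e: "e \<in> arcs R" "tail G e = v" by (rule W_edge)
    then have "(inv_value [Edge e, Ghost e], inv_value [Vertex v]) \<in> ?\<sigma>"
      using gen v unfolding pairs by auto
    with e v W_subset H show "v \<in> T_index_one G ?\<sigma>"
      by (auto simp: S.T_index_one_iff S.quotient_eq_iff S.vertex_nonzero_iff)
  qed
  have "T_exponent G ?\<sigma> c = f c" for c
  proof (cases "c \<in> cycles_in R W")
    case c: True
    \<comment> \<open>Every exponent is a multiple of a finite f(c), and the generating pair makes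
      f(c) itself an exponent; so it is the least one.\<close>
    have power: "S.loop_power c m \<Longrightarrow> \<exists>n. f c = enat n \<and> n dvd m" for m
      using cycle_exponent_dvd[OF c] by (simp add: S.loop_power_iff cycleD(1)[OF c])
    show ?thesis
    proof (cases "f c")
      case (enat n)
      have "n \<noteq> 0" using PiE_mem[OF exponent_PiE c] enat by (simp add: zero_enat_def)
      have "(inv_value (path_word (concat (replicate n c))), inv_value [Vertex (tail G (hd c))]) \<in> ?\<sigma>"
        using gen c enat unfolding pairs by blast
      then have n: "S.loop_power c n" using \<open>n \<noteq> 0\<close> by (simp add: S.loop_power_iff cycleD(1)[OF c])
      moreover have "n \<le> m" if "S.loop_power c m" for m
      proof (rule dvd_imp_le)
        show "n dvd m" using power[OF that] enat by simp
        show "0 < m" using that by (simp add: S.loop_power_def)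
      qed
      ultimately have "(LEAST m. S.loop_power c m) = n" by (rule Least_equality)
      then show ?thesis using c n enat unfolding S.T_exponent_eq H W by auto
    next
      case infinity
      then show ?thesis using c power unfolding S.T_exponent_eq H W by auto
    qed
  next
    case False
    \<comment> \<open>Outside the set of cycles both functions take the default value of extensional
      functions.\<close>
    then show ?thesis
      using exponent_PiE unfolding S.T_exponent_eq H W by (auto simp: PiE_def extensional_def)
  qed
  then show ?thesis by (simp add: T_map_def H W fun_eq_iff)
qed

end

theorem theorem1p4:
  fixes G :: "('v, 'e) pre_digraph"
  assumes "wf_digraph G"
  shows "T_map G \<in> inv_congruences G \<rightarrow> congruence_triples G \<and>
         wp_map G \<in> congruence_triples G \<rightarrow> inv_congruences G \<and>
         (\<forall>\<rho> \<in> inv_congruences G. wp_map G (T_map G \<rho>) = \<rho>) \<and>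
         (\<forall>t \<in> congruence_triples G. T_map G (wp_map G t) = t) \<and>
         (\<exists>\<Phi>. bij_betw \<Phi> (inv_congruences G) (congruence_triples G))"
proof -
  interpret wf_digraph G by (rule assms)
  have congruence: "inv_congruence G \<rho>" if "\<rho> \<in> inv_congruences G" for \<rho>
    using that by unfold_locales (simp add: inv_congruences_def)
  have T: "T_map G \<in> inv_congruences G \<rightarrow> congruence_triples G"
    using inv_congruence.T_map_in_triples[OF congruence] by blast
  moreover have wp: "wp_map G \<in> congruence_triples G \<rightarrow> inv_congruences G"
    using congruence_wp_map by (simp add: inv_congruences_def)
  moreover have wp_T: "\<forall>\<rho> \<in> inv_congruences G. wp_map G (T_map G \<rho>) = \<rho>"
    using inv_congruence.wp_map_T_map[OF congruence] by blast
  moreover have T_wp: "T_map G (wp_map G t) = t" if "t \<in> congruence_triples G" for t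
  proof -
    obtain H W f where t: "t = (H, W, f)" by (metis prod_cases3)
    interpret triple_model G H W f by unfold_locales (use that t in simp)
    show ?thesis unfolding t by (rule T_map_wp_map)
  qed
  moreover have "bij_betw (T_map G) (inv_congruences G) (congruence_triples G)"
    using T wp wp_T T_wp by (intro bij_betw_byWitness[where f' = "wp_map G"]) auto
  ultimately show ?thesis by blast
qed

end
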